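(* Let $0 < c_1 < c_2 < \infty$ and $\mathcal{L} > 0$. Let $\mathbf{v} = (\mathbf{v}_1,\mathbf{v}_2):2 \mathbb{D} \rightarrow \mathbb{R}^2$ be a smooth incompressible vector field (i.e. $\frac{\partial \mathbf{v}_1}{\partial x} + \frac{\partial \mathbf{v}_2}{\partial y} = 0$) with $c_1 \leq \|\mathbf{v}\| \leq c_2$, and let $\mathbf{v}^{\perp} = (-\mathbf{v}_2, \mathbf{v}_1)$. If, for all $p \in \mathbb{D}$, $$ \inf_{t \in \mathbb{R}}{\left\{ | e^{t \mathbf{v}}p |: \|e^{t \mathbf{v}}p - p\| = 1\right\}} \geq \mathcal{L},$$ then $$\inf_{t \in \mathbb{R}}{\left\{ | e^{t \mathbf{v}^{\perp}}(0,0) |: \|e^{t \mathbf{v}^{\perp}}(0,0)\| = 1\right\}} \leq \pi \frac{c_2 / c_1}{\mathcal{L}}.$$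
   Context: $\|\cdot\|$ is the Euclidean norm on $\mathbb{R}^2$; $\mathbb{D}$ is the open unit disk centered at the origin and $2\mathbb{D}$ the disk of radius $2$ centered at the origin. For a vector field $\mathbf{w}$ on $2\mathbb{D}$, $e^{t\mathbf{w}}x$ denotes the flow induced by $\mathbf{w}$: the value at time $t$ of the solution of $\dot\gamma(t) = \mathbf{w}(\gamma(t))$, $\gamma(0) = x$, where both positive and negative $t$ are allowed; $t$ ranges over times for which the solution is defined. The notation $|e^{t\mathbf{w}}x|$ denotes not the norm of a point but the length of the flow line from $x$ to $e^{t\mathbf{w}}x$, i.e. $\left|\int_0^t \left\|\frac{\partial}{\partial u} e^{u\mathbf{w}}x\right\| du\right|$. The infimum of the empty set is $+\infty$. *)

theory Defs
  imports "HOL-Analysis.Analysis"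
begin

text \<open>\<open>Ck_on k f S\<close>: for open \<open>S\<close>, the map \<open>f\<close> is \<open>k\<close> times continuously differentiable on \<open>S\<close>.\<close>

primrec Ck_on ::
    "nat \<Rightarrow> ('a::real_normed_vector \<Rightarrow> 'b::real_normed_vector) \<Rightarrow> 'a set \<Rightarrow> bool" where
  "Ck_on 0 f S \<longleftrightarrow> continuous_on S f"
| "Ck_on (Suc k) f S \<longleftrightarrow>
     (\<forall>x\<in>S. f differentiable (at x)) \<and>
     (\<forall>h. Ck_on k (\<lambda>x. frechet_derivative f (at x) h) S)"

definition smooth_on :: "('a::real_normed_vector \<Rightarrow> 'b::real_normed_vector) \<Rightarrow> 'a set \<Rightarrow> bool" where
  "smooth_on f S \<longleftrightarrow> (\<forall>k. Ck_on k f S)"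

definition divergence :: "(real^'n \<Rightarrow> real^'n) \<Rightarrow> real^'n \<Rightarrow> real" where
  "divergence w p = (\<Sum>i\<in>UNIV. frechet_derivative w (at p) (axis i 1) $ i)"

definition incompressible_on :: "(real^'n \<Rightarrow> real^'n) \<Rightarrow> (real^'n) set \<Rightarrow> bool" where
  "incompressible_on w S \<longleftrightarrow> (\<forall>p\<in>S. divergence w p = 0)"

definition perp :: "(real^2 \<Rightarrow> real^2) \<Rightarrow> real^2 \<Rightarrow> real^2" where
  "perp w p = vector [- (w p $ 2), w p $ 1]"

text \<open>A vector field on an open set \<open>S\<close> is a total function of which only the values on \<open>S\<close>
  matter; its integral curves must therefore stay in \<open>S\<close>.\<close>

definition integral_curve ::
    "('a::real_normed_vector \<Rightarrow> 'a) \<Rightarrow> 'a set \<Rightarrow> 'a \<Rightarrow> real set \<Rightarrow> (real \<Rightarrow> 'a) \<Rightarrow> bool" where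
  "integral_curve w S x I \<gamma> \<longleftrightarrow>
     open I \<and> is_interval I \<and> 0 \<in> I \<and> \<gamma> 0 = x \<and>
     (\<forall>t\<in>I. \<gamma> t \<in> S \<and> (\<gamma> has_vector_derivative w (\<gamma> t)) (at t))"

text \<open>The maximal interval of existence of the solution starting at \<open>x\<close>, and the flow on it. For a
  smooth field, integral curves are unique, so that the description below is proper for every
  \<open>t \<in> flow_times w S x\<close>; outside this set the value of \<open>flow w S t x\<close> carries no meaning.\<close>

definition flow_times :: "('a::real_normed_vector \<Rightarrow> 'a) \<Rightarrow> 'a set \<Rightarrow> 'a \<Rightarrow> real set" where
  "flow_times w S x = {t. \<exists>I \<gamma>. integral_curve w S x I \<gamma> \<and> t \<in> I}"

definition flow :: "('a::real_normed_vector \<Rightarrow> 'a) \<Rightarrow> 'a set \<Rightarrow> real \<Rightarrow> 'a \<Rightarrow> 'a" where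
  "flow w S t x = (THE y. \<exists>I \<gamma>. integral_curve w S x I \<gamma> \<and> t \<in> I \<and> \<gamma> t = y)"

text \<open>The interval integral is oriented, hence the absolute value for negative \<open>t\<close>.\<close>

definition flow_length :: "('a::real_normed_vector \<Rightarrow> 'a) \<Rightarrow> 'a set \<Rightarrow> real \<Rightarrow> 'a \<Rightarrow> real" where
  "flow_length w S t x =
     \<bar>LBINT u=ereal 0..ereal t. norm (vector_derivative (\<lambda>s. flow w S s x) (at u))\<bar>"

text \<open>The infimum is taken in the extended reals, so that it is \<open>\<infinity>\<close> if the flow line through \<open>x\<close>
  never reaches distance 1 from \<open>x\<close>.\<close>

definition unit_escape_length :: "('a::real_normed_vector \<Rightarrow> 'a) \<Rightarrow> 'a set \<Rightarrow> 'a \<Rightarrow> ereal" where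
  "unit_escape_length w S x =
     (INF t\<in>{t \<in> flow_times w S x. norm (flow w S t x - x) = 1}. ereal (flow_length w S t x))"

end

theory Submission
  imports Defs
begin

text \<open>Since \<open>v\<close> is divergence free, \<open>perp v = grad \<psi>\<close> for a stream function \<open>\<psi>\<close>. Let \<open>\<beta>\<close> be the unit speed
  integral curve of \<open>perp v\<close> with \<open>\<beta> 0 = 0\<close>, put \<open>M = \<pi> (c\<^sub>2 / c\<^sub>1) / L\<close>, and suppose that \<open>\<beta>\<close> stays in
  the open unit disk on \<open>[-M, M]\<close>. For \<open>\<bar>t\<bar> < T = L / c\<^sub>2\<close> the flow line of \<open>v\<close> from \<open>\<beta> s\<close> has length less
  than \<open>L\<close>, hence stays within distance 1 of \<open>\<beta> s\<close>. Consider \<open>F (s, t) = e\<^sup>t\<^sup>v (\<beta> s)\<close> on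
  \<open>(-M, M) \<times> (-T, T)\<close>. As \<open>\<psi> (F (s, t)) = \<psi> (\<beta> s)\<close>, its Jacobian is \<open>\<parallel>v (\<beta> s)\<parallel> \<ge> c\<^sub>1\<close> in absolute
  value. It is injective: \<open>\<psi>\<close> separates different \<open>s\<close>, and \<open>v\<close> has no closed orbit. So the image has
  area at least \<open>4 M T c\<^sub>1 = 4 \<pi>\<close>, although it lies in a disk of radius less than 2. Both directions
  of \<open>\<beta>\<close> contribute, which is why the constant is \<open>\<pi>\<close> and not \<open>2 \<pi>\<close>.\<close>

section \<open>Ordinary differential equations\<close>

text \<open>The norm need not be differentiable where \<open>e\<close> vanishes, so the argument
  runs with \<open>e u \<bullet> e u + B\<^sup>2\<close>, whose product with
  \<open>exp (- (C * u))\<close> is nonincreasing. Adding \<open>B\<^sup>2\<close> absorbs the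
  inhomogeneous term.\<close>

lemma gronwall_forward:
  fixes e :: "real \<Rightarrow> 'a::real_inner"
  assumes "0 \<le> t" "0 \<le> K" "0 \<le> B"
    and der: "\<And>u. u \<in> {0..t} \<Longrightarrow> (e has_vector_derivative e' u) (at u)"
    and bound: "\<And>u. u \<in> {0..t} \<Longrightarrow> norm (e' u) \<le> K * norm (e u) + B"
  shows "norm (e t) \<le> (norm (e 0) + B) * exp ((K + 1) * t)"
proof -
  \<comment> \<open>\<open>2 * K\<close> comes from differentiating the square, and the extra 1 from
    \<open>2 * norm (e u) * B \<le> (norm (e u))\<^sup>2 + B\<^sup>2\<close>.\<close>
  define C where "C = 2 * K + 1"
  have C: "C \<ge> 1" using assms by (simp add: C_def)
  define g where "g = (\<lambda>u. (e u \<bullet> e u + B\<^sup>2) * exp (- (C * u)))"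
  have "g t \<le> g 0"
  proof (rule DERIV_nonpos_imp_nonincreasing[OF \<open>0 \<le> t\<close>])
    fix u assume u: "0 \<le> u" "u \<le> t"
    let ?D = "(2 * (e u \<bullet> e' u) - C * (e u \<bullet> e u + B\<^sup>2)) * exp (- (C * u))"
    have "((\<lambda>u. e u \<bullet> e u) has_real_derivative 2 * (e u \<bullet> e' u)) (at u)"
      using has_derivative_inner[OF der[of u, unfolded has_vector_derivative_def] der[of u, unfolded has_vector_derivative_def]] u
      unfolding has_field_derivative_def
      by (auto simp: inner_commute algebra_simps elim!: has_derivative_eq_rhs)
    then have "(g has_real_derivative ?D) (at u)"
      unfolding g_def by (auto intro!: derivative_eq_intros simp: algebra_simps)
    moreover have "2 * (e u \<bullet> e' u) \<le> C * (e u \<bullet> e u + B\<^sup>2)"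
    proof -
      have "e u \<bullet> e' u \<le> norm (e u) * norm (e' u)" by (rule norm_cauchy_schwarz)
      also have "\<dots> \<le> norm (e u) * (K * norm (e u) + B)"
        using bound[of u] u by (intro mult_left_mono) auto
      also have "2 * \<dots> \<le> C * (norm (e u))\<^sup>2 + B\<^sup>2"
        using sum_squares_bound[of "norm (e u)" B] by (simp add: C_def algebra_simps power2_eq_square)
      also have "\<dots> \<le> C * ((norm (e u))\<^sup>2 + B\<^sup>2)"
        using mult_right_mono[OF C, of "B\<^sup>2"] by (simp add: algebra_simps)
      finally show ?thesis by (simp add: power2_norm_eq_inner)
    qed
    ultimately show "\<exists>y. DERIV g u :> y \<and> y \<le> 0"
      by (intro exI[of _ ?D]) (auto simp: mult_le_0_iff)
  qed
  then have "(norm (e t))\<^sup>2 + B\<^sup>2 \<le> ((norm (e 0))\<^sup>2 + B\<^sup>2) * exp (C * t)"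
    by (simp add: g_def exp_minus field_simps power2_norm_eq_inner)
  also have "\<dots> \<le> (norm (e 0) + B)\<^sup>2 * exp (C * t)"
    using assms by (intro mult_right_mono) (auto simp: power2_eq_square algebra_simps)
  \<comment> \<open>The rate \<open>2 * K + 1\<close> is rounded up to \<open>2 * (K + 1)\<close>,
    which makes the right-hand side a square, so that the root can be taken.\<close>
  also have "\<dots> \<le> (norm (e 0) + B)\<^sup>2 * exp (2 * ((K + 1) * t))"
    using assms by (intro mult_left_mono) (auto simp: C_def algebra_simps)
  also have "\<dots> = ((norm (e 0) + B) * exp ((K + 1) * t))\<^sup>2"
    by (simp add: power_mult_distrib exp_double)
  finally have "(norm (e t))\<^sup>2 \<le> ((norm (e 0) + B) * exp ((K + 1) * t))\<^sup>2"
    by (smt (verit) zero_le_power2)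
  then show ?thesis
    using assms by (auto intro: power2_le_imp_le)
qed

lemma has_vector_derivative_reflect:
  assumes "(f has_vector_derivative d) (at (- u))"
  shows "((\<lambda>x. f (- x)) has_vector_derivative - d) (at (u::real))"
proof -
  have "(uminus has_vector_derivative - 1) (at u)"
    by (auto intro!: derivative_eq_intros)
  from vector_diff_chain_at[OF this assms] show ?thesis
    by (simp add: o_def)
qed

lemma gronwall:
  fixes e :: "real \<Rightarrow> 'a::real_inner"
  assumes "0 \<le> K" "0 \<le> B"
    and der: "\<And>u. u \<in> closed_segment 0 t \<Longrightarrow> (e has_vector_derivative e' u) (at u)"
    and bound: "\<And>u. u \<in> closed_segment 0 t \<Longrightarrow> norm (e' u) \<le> K * norm (e u) + B"
  shows "norm (e t) \<le> (norm (e 0) + B) * exp ((K + 1) * \<bar>t\<bar>)"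
proof (cases "0 \<le> t")
  case True
  then show ?thesis
    using gronwall_forward[of t K B e e'] assms by (simp add: closed_segment_eq_real_ivl)
next
  case False
  have "norm (e (- (- t))) \<le> (norm (e (- 0)) + B) * exp ((K + 1) * (- t))"
    by (rule gronwall_forward[where e = "\<lambda>u. e (- u)" and e' = "\<lambda>u. - e' (- u)"])
      (use False assms in \<open>auto simp: closed_segment_eq_real_ivl intro!: has_vector_derivative_reflect\<close>)
  then show ?thesis using False by simp
qed

text \<open>Integrating a bound with an exponential weight of rate \<open>k\<close> returns the same
  weight divided by \<open>k\<close>. This gain is what makes Picard iteration contract in a
  weighted norm.\<close>

lemma norm_le_exp_of_derivative:
  fixes f :: "real \<Rightarrow> 'a::real_normed_vector"
  assumes "0 \<le> c" "0 < k" "f 0 = 0"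
    and der: "\<And>u. (f has_vector_derivative f' u) (at u)"
    and bound: "\<And>u. norm (f' u) \<le> c * k * exp (k * \<bar>u\<bar>)"
  shows "norm (f t) \<le> c * exp (k * \<bar>t\<bar>)"
proof -
  have *: "norm (g t) \<le> c * exp (k * t)"
    if "0 < t" and g: "\<And>u. (g has_vector_derivative g' u) (at u)" "g 0 = 0"
      "\<And>u. norm (g' u) \<le> c * k * exp (k * \<bar>u\<bar>)" for g :: "real \<Rightarrow> 'a" and g' t
  proof -
    have "norm (g t - g 0) \<le> c * exp (k * t) - c * exp (k * 0)"
    proof (rule differentiable_bound_general[OF \<open>0 < t\<close>, where f' = g' and \<phi>' = "\<lambda>u. c * k * exp (k * u)"])
      show "continuous_on {0..t} g"
        using g(1) by (meson continuous_at_imp_continuous_on has_vector_derivative_continuous)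
      show "((\<lambda>u. c * exp (k * u)) has_vector_derivative c * k * exp (k * x)) (at x)" for x
        by (auto intro!: derivative_eq_intros simp flip: has_real_derivative_iff_has_vector_derivative)
      show "norm (g' x) \<le> c * k * exp (k * x)" if "0 < x" for x
        using g(3)[of x] that by simp
    qed (auto intro!: continuous_intros g)
    then show ?thesis using \<open>0 \<le> c\<close> g by simp
  qed
  consider "t > 0" | "t = 0" | "t < 0" by linarith
  then show ?thesis
  proof cases
    case 3
    then show ?thesis
      using *[of "-t" "\<lambda>u. f (- u)" "\<lambda>u. - f' (- u)"] has_vector_derivative_reflect[OF der] bound assms(3)
      by (metis (no_types, lifting) abs_minus_cancel abs_of_neg minus_minus neg_0_less_iff_less neg_equal_0_iff_equal norm_minus_cancel)
  qed (use * assms in auto)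
qed

lemma antiderivative_UNIV:
  fixes f :: "real \<Rightarrow> 'a::euclidean_space"
  assumes "continuous_on UNIV f"
  obtains F where "F 0 = a" "\<And>t. (F has_vector_derivative f t) (at t)"
proof -
  obtain G where G: "\<And>t. (G has_vector_derivative f t) (at t)"
    using einterval_antiderivative[of "-\<infinity>" "\<infinity>" f] assms
    by (auto simp: continuous_on_eq_continuous_at)
  show thesis
    by (rule that[of "\<lambda>t. G t - G 0 + a"]) (auto intro!: derivative_eq_intros G)
qed

text \<open>With one Lipschitz constant for all times and states, the Picard iterates converge on
  the whole line, so that no maximal interval of existence has to be discussed. The bound at
  \<open>x0\<close> controls the first increment.\<close>

lemma Picard_Lindeloef_global:
  fixes f :: "real \<Rightarrow> 'a::euclidean_space \<Rightarrow> 'a"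
  assumes cont: "continuous_on UNIV (\<lambda>(t, x). f t x)"
    and lip: "\<And>t x y. norm (f t x - f t y) \<le> K * norm (x - y)"
    and bound: "\<And>t. norm (f t x0) \<le> B"
  obtains X where "X 0 = x0" "\<And>t. (X has_vector_derivative f t (X t)) (at t)"
proof -
  define k where "k = \<bar>K\<bar> + 1"
  have k: "k > 0" "\<bar>K\<bar> \<le> k" by (auto simp: k_def)
  have lip: "norm (f t x - f t y) \<le> k * norm (x - y)" for t x y
    by (rule order_trans[OF lip]) (auto intro!: mult_right_mono simp: k_def)
  have cont_f: "continuous_on UNIV (\<lambda>t. f t (Y t))" if "continuous_on UNIV Y" for Y :: "real \<Rightarrow> 'a"
    using continuous_on_compose2[OF cont continuous_on_Pair[OF continuous_on_id that]] by auto
  have contI: "continuous_on UNIV Y" if "\<And>t. (Y has_vector_derivative Y' t) (at t)" for Y Y' :: "real \<Rightarrow> 'a"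
    using that by (meson continuous_at_imp_continuous_on has_vector_derivative_continuous)
  let ?good = "\<lambda>Y. Y 0 = x0 \<and> continuous_on UNIV Y"
  let ?next = "\<lambda>Y Z. \<forall>t. (Z has_vector_derivative f t (Y t)) (at t)"
  have "\<exists>Z. ?good Z \<and> ?next Y Z" if Y: "?good Y" for Y
  proof -
    obtain Z where Z: "Z 0 = x0" "\<And>t. (Z has_vector_derivative f t (Y t)) (at t)"
      using antiderivative_UNIV[OF cont_f[of Y]] Y by metis
    from Z(1) contI[of Z, OF Z(2)] Z(2) show ?thesis by (intro exI conjI allI)
  qed
  \<comment> \<open>The clause for \<open>n = 0\<close> is carried along in the invariant to pin the
    start of the iteration to the constant \<open>x0\<close>.\<close>
  then have "\<exists>Xs. \<forall>n. (?good (Xs n) \<and> (n = 0 \<longrightarrow> Xs n = (\<lambda>_. x0))) \<and> ?next (Xs n) (Xs (Suc n))"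
    by (intro dependent_nat_choice[where P = "\<lambda>n Y. ?good Y \<and> (n = 0 \<longrightarrow> Y = (\<lambda>_. x0))" and Q = "\<lambda>n. ?next"]) auto
  then obtain Xs where Xs: "\<And>n. Xs n 0 = x0" "Xs 0 = (\<lambda>_. x0)"
      "\<And>n t. (Xs (Suc n) has_vector_derivative f t (Xs n t)) (at t)"
    by blast
  have B: "B \<ge> 0" using bound[of 0] norm_ge_zero order_trans by blast
  \<comment> \<open>The weight \<open>exp (2 * k * \<bar>t\<bar>)\<close> makes every Picard iteration halve the error, for all times at once.\<close>
  define c where "c = B / (2 * k)"
  have c: "c \<ge> 0" using B k by (simp add: c_def)
  define d where "d n t = Xs (Suc n) t - Xs n t" for n t
  have d: "norm (d n t) \<le> c / 2 ^ n * exp (2 * k * \<bar>t\<bar>)" for n t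
  proof (induction n arbitrary: t)
    case 0
    have "norm (f t x0) \<le> B * exp (2 * k * \<bar>t\<bar>)" for t
      using bound[of t] B k mult_left_mono[of 1 "exp (2 * k * \<bar>t\<bar>)" B] by auto
    moreover have "(d 0 has_vector_derivative f u x0) (at u)" for u
      using has_vector_derivative_diff[OF Xs(3)[of 0 u] has_vector_derivative_const[of x0]]
      by (simp add: d_def[abs_def] Xs(2))
    moreover have "d 0 0 = 0" by (simp add: d_def Xs(1))
    ultimately have "norm (d 0 t) \<le> c * exp (2 * k * \<bar>t\<bar>)"
      using norm_le_exp_of_derivative[of c "2 * k" "d 0" "\<lambda>t. f t x0" t] k c by (simp add: c_def)
    then show ?case by simp
  next
    case (Suc n)
    show ?case
    proof (rule norm_le_exp_of_derivative[where f' = "\<lambda>t. f t (Xs (Suc n) t) - f t (Xs n t)"])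
      show "(d (Suc n) has_vector_derivative f u (Xs (Suc n) u) - f u (Xs n u)) (at u)" for u
        unfolding d_def by (intro has_vector_derivative_diff Xs)
      show "norm (f u (Xs (Suc n) u) - f u (Xs n u)) \<le> c / 2 ^ Suc n * (2 * k) * exp (2 * k * \<bar>u\<bar>)" for u
      proof -
        have "norm (f u (Xs (Suc n) u) - f u (Xs n u)) \<le> k * norm (d n u)"
          unfolding d_def by (rule lip)
        also have "\<dots> \<le> k * (c / 2 ^ n * exp (2 * k * \<bar>u\<bar>))"
          using k by (intro mult_left_mono Suc) auto
        finally show ?thesis by (simp add: field_simps)
      qed
    qed (use c k Xs in \<open>auto simp: d_def\<close>)
  qed
  have sum_d: "(\<Sum>i<n. d i t) = Xs n t - x0" for n t
    using sum_lessThan_telescope[of "\<lambda>i. Xs i t" n] by (simp add: d_def Xs(2))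
  define X where "X t = x0 + (\<Sum>i. d i t)" for t
  \<comment> \<open>The weight is bounded on bounded intervals only, so convergence is uniform there
    and not on the whole line.\<close>
  have unif: "uniform_limit {-R<..<R} Xs X sequentially" for R
  proof -
    have "uniform_limit {-R<..<R} (\<lambda>n t. \<Sum>i<n. d i t) (\<lambda>t. \<Sum>i. d i t) sequentially"
    proof (rule Weierstrass_m_test)
      show "norm (d n t) \<le> c * exp (2 * k * R) * (1 / 2) ^ n" if "t \<in> {-R<..<R}" for n t
      proof -
        have "exp (2 * k * \<bar>t\<bar>) \<le> exp (2 * k * R)" using that k by auto
        then have "c / 2 ^ n * exp (2 * k * \<bar>t\<bar>) \<le> c / 2 ^ n * exp (2 * k * R)"
          using c by (intro mult_left_mono) auto
        with d[of n t] show ?thesis by (simp add: field_simps power_divide)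
      qed
      show "summable (\<lambda>n. c * exp (2 * k * R) * (1 / 2) ^ n :: real)"
        by (intro summable_mult summable_geometric) auto
    qed
    from uniform_limit_add[OF uniform_limit_const[where c = "\<lambda>_. x0"] this] show ?thesis
      by (simp add: sum_d X_def[abs_def])
  qed
  have lim: "(\<lambda>n. Xs n t) \<longlonglongrightarrow> X t" for t
    by (rule tendsto_uniform_limitI[OF unif[of "\<bar>t\<bar> + 1"]]) (simp, linarith)
  show thesis
  proof (rule that[of X])
    show "X 0 = x0" using lim[of 0] by (simp add: Xs LIMSEQ_const_iff)
    fix t :: real
    define S where "S = {-(\<bar>t\<bar> + 1)<..<\<bar>t\<bar> + 1}"
    have S: "open S" "t \<in> S" "convex S" by (auto simp: S_def)
    \<comment> \<open>Termwise differentiation. The sequence is shifted by one because the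
      derivative of \<open>Xs (Suc n)\<close> is \<open>f\<close> along \<open>Xs n\<close>; the
      limit \<open>g\<close> is then identified with \<open>X\<close> on \<open>S\<close>.\<close>
    have "\<exists>g. \<forall>x\<in>S. (\<lambda>n. Xs (Suc n) x) \<longlonglongrightarrow> g x \<and> (g has_derivative (\<lambda>h. h *\<^sub>R f x (X x))) (at x within S)"
    proof (rule has_derivative_sequence[where f' = "\<lambda>n x h. h *\<^sub>R f x (Xs n x)", OF \<open>convex S\<close> _ _ S(2)])
      show "(Xs (Suc n) has_derivative (\<lambda>h. h *\<^sub>R f x (Xs n x))) (at x within S)" for n x
        using Xs(3)[of n x] unfolding has_vector_derivative_def by (rule has_derivative_at_withinI)
      show "(\<lambda>n. Xs (Suc n) t) \<longlonglongrightarrow> X t" by (rule LIMSEQ_Suc[OF lim])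
      fix e :: real assume e: "e > 0"
      then have "\<forall>\<^sub>F n in sequentially. \<forall>x\<in>S. dist (Xs n x) (X x) < e / k"
        using unif[of "\<bar>t\<bar> + 1"] k unfolding uniform_limit_iff S_def by (meson divide_pos_pos)
      then show "\<forall>\<^sub>F n in sequentially. \<forall>x\<in>S. \<forall>h. norm (h *\<^sub>R f x (Xs n x) - h *\<^sub>R f x (X x)) \<le> e * norm h"
      proof eventually_elim
        case (elim n)
        show ?case
        proof (intro ballI allI)
          fix x h :: real assume "x \<in> S"
          have "norm (f x (Xs n x) - f x (X x)) \<le> k * norm (Xs n x - X x)" by (rule lip)
          also have "\<dots> \<le> e" using elim[rule_format, OF \<open>x \<in> S\<close>] k by (simp add: dist_norm field_simps)
          finally show "norm (h *\<^sub>R f x (Xs n x) - h *\<^sub>R f x (X x)) \<le> e * norm h"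
            by (simp add: mult.commute[of e] mult_left_mono flip: scaleR_diff_right)
        qed
      qed
    qed
    then obtain g where g: "\<And>x. x \<in> S \<Longrightarrow> (\<lambda>n. Xs (Suc n) x) \<longlonglongrightarrow> g x"
        "\<And>x. x \<in> S \<Longrightarrow> (g has_derivative (\<lambda>h. h *\<^sub>R f x (X x))) (at x within S)"
      by blast
    have gX: "g x = X x" if "x \<in> S" for x
      using LIMSEQ_unique[OF g(1)[OF that] LIMSEQ_Suc[OF lim]] .
    have "(X has_derivative (\<lambda>h. h *\<^sub>R f t (X t))) (at t within S)"
      by (rule has_derivative_transform[OF S(2) _ g(2)[OF S(2)]]) (simp add: gX)
    then show "(X has_vector_derivative f t (X t)) (at t)"
      by (simp only: has_vector_derivative_def at_within_open[OF S(2,1)])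
  qed
qed

section \<open>Integral curves and escape lengths\<close>

lemma Ck_on_Suc_imp: "Ck_on (Suc k) f S \<Longrightarrow> Ck_on k f S"
proof (induction k arbitrary: f)
  case 0
  then show ?case
    by (auto intro!: continuous_at_imp_continuous_on differentiable_imp_continuous_within)
next
  case (Suc k)
  have "\<forall>x\<in>S. f differentiable at x" "\<And>h. Ck_on (Suc k) (\<lambda>x. frechet_derivative f (at x) h) S"
    using Suc.prems unfolding Ck_on.simps(2)[of "Suc k"] by simp_all
  then show ?case unfolding Ck_on.simps(2)[of k] using Suc.IH by simp
qed

text \<open>\<open>Ck_on\<close> controls derivatives in one fixed direction at a time; bounds for
  all directions are assembled from the finitely many basis directions.\<close>

lemma norm_linear_le_sum_Basis:
  fixes f :: "'a::euclidean_space \<Rightarrow> 'b::real_normed_vector"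
  assumes "linear f" and b: "\<And>i. i \<in> Basis \<Longrightarrow> norm (f i) \<le> b i"
  shows "norm (f h) \<le> (\<Sum>i\<in>Basis. b i) * norm h"
proof -
  have "norm (f h) = norm (\<Sum>i\<in>Basis. (h \<bullet> i) *\<^sub>R f i)"
    by (subst euclidean_representation[of h, symmetric])
       (simp only: linear_sum[OF \<open>linear f\<close>] linear_cmul[OF \<open>linear f\<close>])
  also have "\<dots> \<le> (\<Sum>i\<in>Basis. norm h * b i)"
  proof (rule sum_norm_le)
    fix i :: 'a assume i: "i \<in> Basis"
    show "norm ((h \<bullet> i) *\<^sub>R f i) \<le> norm h * b i"
      using mult_mono[OF Basis_le_norm[OF i, of h] b[OF i]] by simp
  qed
  finally show ?thesis by (simp add: sum_distrib_left mult.commute)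
qed

text \<open>Each directional derivative is continuous, hence bounded on the compact set; on a convex
  set the mean value inequality turns the resulting bound on the derivative into a Lipschitz
  bound.\<close>

lemma C1_lipschitz:
  fixes g :: "'a::euclidean_space \<Rightarrow> 'b::real_normed_vector"
  assumes g: "Ck_on (Suc 0) g S" and C: "compact C" "convex C" "C \<subseteq> S"
  obtains K where "0 \<le> K"
    "\<And>x h. x \<in> C \<Longrightarrow> norm (frechet_derivative g (at x) h) \<le> K * norm h"
    "\<And>x y. x \<in> C \<Longrightarrow> y \<in> C \<Longrightarrow> norm (g x - g y) \<le> K * norm (x - y)"
proof -
  let ?D = "\<lambda>x. frechet_derivative g (at x)"
  have der: "(g has_derivative ?D x) (at x)" if "x \<in> C" for x
    using g C that frechet_derivative_works by auto
  have "\<exists>b\<ge>0. \<forall>x\<in>C. norm (?D x i) \<le> b" for i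
  proof -
    have "continuous_on C (\<lambda>x. ?D x i)"
      using g C(3) by (auto intro: continuous_on_subset)
    from compact_imp_bounded[OF compact_continuous_image[OF this C(1)]]
    show ?thesis unfolding bounded_pos by (auto intro: less_imp_le)
  qed
  then obtain b where b: "\<And>i. 0 \<le> b i" "\<And>i x. x \<in> C \<Longrightarrow> norm (?D x i) \<le> b i"
    by metis
  define K where "K = (\<Sum>i\<in>Basis. b i)"
  have "0 \<le> K" unfolding K_def by (intro sum_nonneg b)
  moreover have K: "norm (?D x h) \<le> K * norm h" if "x \<in> C" for x h
    unfolding K_def using b that has_derivative_linear[OF der[OF that]]
    by (intro norm_linear_le_sum_Basis) auto
  moreover have "norm (g x - g y) \<le> K * norm (x - y)" if "x \<in> C" "y \<in> C" for x y
    using that K by (intro differentiable_bound[OF C(2), of g ?D]) (auto intro: der has_derivative_at_withinI onorm_le)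
  ultimately show thesis by (rule that)
qed

text \<open>\<open>C1_lipschitz\<close>, applied to the directional derivatives, makes the
  derivative itself Lipschitz in operator norm. The mean value inequality for \<open>g\<close> minus
  its linearization at \<open>x\<close> then gives a quadratic remainder.\<close>

lemma C2_taylor:
  fixes g :: "'a::euclidean_space \<Rightarrow> 'b::real_normed_vector"
  assumes g: "Ck_on (Suc (Suc 0)) g S" and C: "compact C" "convex C" "C \<subseteq> S"
  obtains K where "0 \<le> K"
    "\<And>x y. x \<in> C \<Longrightarrow> y \<in> C \<Longrightarrow>
       norm (g y - g x - frechet_derivative g (at x) (y - x)) \<le> K * (norm (y - x))\<^sup>2"
proof -
  let ?D = "\<lambda>x. frechet_derivative g (at x)"
  have der: "(g has_derivative ?D x) (at x)" if "x \<in> C" for x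
    using g C that frechet_derivative_works by auto
  have "\<exists>b\<ge>0. \<forall>x\<in>C. \<forall>y\<in>C. norm (?D x i - ?D y i) \<le> b * norm (x - y)" for i
  proof -
    have "Ck_on (Suc 0) (\<lambda>x. ?D x i) S" using g by (simp del: Ck_on.simps(2) add: Ck_on.simps(2)[of "Suc 0" g])
    then obtain K where "0 \<le> K"
        "\<And>x h. x \<in> C \<Longrightarrow> norm (frechet_derivative (\<lambda>x. ?D x i) (at x) h) \<le> K * norm h"
        "\<And>x y. x \<in> C \<Longrightarrow> y \<in> C \<Longrightarrow> norm (?D x i - ?D y i) \<le> K * norm (x - y)"
      using C by (rule C1_lipschitz) (rule that; assumption)
    then show ?thesis by (intro exI[of _ K]) auto
  qed
  then obtain b where b: "\<And>i. 0 \<le> b i"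
      "\<And>i x y. x \<in> C \<Longrightarrow> y \<in> C \<Longrightarrow> norm (?D x i - ?D y i) \<le> b i * norm (x - y)"
    by metis
  define K where "K = (\<Sum>i\<in>Basis. b i)"
  have "0 \<le> K" unfolding K_def by (intro sum_nonneg b)
  moreover have "norm (g y - g x - ?D x (y - x)) \<le> K * (norm (y - x))\<^sup>2" if xy: "x \<in> C" "y \<in> C" for x y
  proof -
    have sub: "closed_segment x y \<subseteq> C" using C(2) xy by (simp add: convex_contains_segment)
    have "norm (g y - g x - ?D x (y - x)) \<le> norm (y - x) * (K * norm (y - x))"
    proof (rule differentiable_bound_linearization[where S = "closed_segment x y"])
      show "x + t *\<^sub>R (y - x) \<in> closed_segment x y" if "t \<in> {0..1}" for t
        using that by (auto simp: closed_segment_def algebra_simps intro!: exI[of _ t])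
      show "(g has_derivative ?D z) (at z within closed_segment x y)" if "z \<in> closed_segment x y" for z
        using der sub that by (blast intro: has_derivative_at_withinI)
      show "onorm (?D z - ?D x) \<le> K * norm (y - x)" if z: "z \<in> closed_segment x y" for z
      proof (rule onorm_le)
        fix h
        have "linear (?D z - ?D x)"
          unfolding fun_diff_def
          using has_derivative_linear[OF der] sub z xy by (intro linear_compose_sub) auto
        moreover have "norm ((?D z - ?D x) i) \<le> b i * norm (y - x)" for i
        proof -
          have "norm (?D z i - ?D x i) \<le> b i * norm (z - x)"
            using sub z xy by (intro b) auto
          also have "\<dots> \<le> b i * norm (y - x)"
            using segment_bound(1)[OF z] b(1) by (intro mult_left_mono) auto
          finally show ?thesis by simp
        qed
        ultimately have "norm ((?D z - ?D x) h) \<le> (\<Sum>i\<in>Basis. b i * norm (y - x)) * norm h"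
          by (rule norm_linear_le_sum_Basis)
        then show "norm ((?D z - ?D x) h) \<le> K * norm (y - x) * norm h"
          by (simp add: K_def sum_distrib_right)
      qed
    qed auto
    then show ?thesis by (simp add: power2_eq_square mult_ac)
  qed
  ultimately show thesis by (rule that)
qed

text \<open>The norm attains its maximum on a compact set, which leaves room below \<open>R\<close>.
  This room provides a Lipschitz constant along compact arcs, and later the strict inequality
  between areas.\<close>

lemma compact_subset_ball_imp_cball:
  fixes A :: "'a::real_normed_vector set"
  assumes "compact A" "A \<subseteq> ball 0 R"
  obtains r where "r < R" "A \<subseteq> cball 0 r"
proof (cases "A = {}")
  case False
  obtain a where "a \<in> A" "\<And>y. y \<in> A \<Longrightarrow> norm y \<le> norm a"
    using continuous_attains_sup[OF assms(1) False, of norm] by (auto intro: continuous_intros)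
  moreover from this have "norm a < R" using assms(2) by auto
  ultimately show thesis using that[of "norm a"] by (simp add: subset_iff)
qed (use that[of "R - 1"] in auto)

text \<open>A smooth field on an open ball need not be Lipschitz up to the boundary, hence a
  constant for each smaller closed ball.\<close>

definition lipschitz_inside_ball :: "('a::real_normed_vector \<Rightarrow> 'a) \<Rightarrow> real \<Rightarrow> bool" where
  "lipschitz_inside_ball w R \<longleftrightarrow> (\<forall>r<R. \<exists>K. K-lipschitz_on (cball 0 r) w)"

text \<open>Both arcs from time 0 to \<open>t\<close> are compact, so they lie in a common smaller
  closed ball, where the field is Lipschitz. Gronwall with initial difference 0 and
  \<open>B = 0\<close> finishes.\<close>

lemma integral_curve_unique:
  fixes w :: "'a::euclidean_space \<Rightarrow> 'a"
  assumes lip: "lipschitz_inside_ball w R"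
    and "integral_curve w (ball 0 R) x I \<gamma>" "integral_curve w (ball 0 R) x J \<delta>"
    and "t \<in> I" "t \<in> J"
  shows "\<gamma> t = \<delta> t"
proof -
  let ?T = "closed_segment 0 t"
  have subI: "?T \<subseteq> I" and subJ: "?T \<subseteq> J"
    using assms(2-5) by (simp_all add: integral_curve_def closed_segment_subset is_interval_convex)
  have g: "\<gamma> 0 = x" "\<And>u. u \<in> ?T \<Longrightarrow> \<gamma> u \<in> ball 0 R"
      "\<And>u. u \<in> ?T \<Longrightarrow> (\<gamma> has_vector_derivative w (\<gamma> u)) (at u)"
    using assms(2) subI subJ by (auto simp: integral_curve_def)
  have d: "\<delta> 0 = x" "\<And>u. u \<in> ?T \<Longrightarrow> \<delta> u \<in> ball 0 R"
      "\<And>u. u \<in> ?T \<Longrightarrow> (\<delta> has_vector_derivative w (\<delta> u)) (at u)"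
    using assms(3) subI subJ by (auto simp: integral_curve_def)
  have "continuous_on ?T \<gamma>" "continuous_on ?T \<delta>"
    using g d by (auto intro!: continuous_at_imp_continuous_on has_vector_derivative_continuous)
  then have "compact (\<gamma> ` ?T \<union> \<delta> ` ?T)"
    by (intro compact_Un compact_continuous_image) auto
  then obtain r where r: "r < R" "\<gamma> ` ?T \<union> \<delta> ` ?T \<subseteq> cball 0 r"
    using compact_subset_ball_imp_cball[of "\<gamma> ` ?T \<union> \<delta> ` ?T" R] g(2) d(2) by blast
  then obtain K where K: "K-lipschitz_on (cball 0 r) w"
    using lip unfolding lipschitz_inside_ball_def by blast
  have "norm (\<gamma> t - \<delta> t) \<le> (norm (\<gamma> 0 - \<delta> 0) + 0) * exp ((K + 1) * \<bar>t\<bar>)"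
  proof (rule gronwall[where e' = "\<lambda>u. w (\<gamma> u) - w (\<delta> u)"])
    fix u assume u: "u \<in> ?T"
    show "((\<lambda>u. \<gamma> u - \<delta> u) has_vector_derivative w (\<gamma> u) - w (\<delta> u)) (at u)"
      using g(3) d(3) u by (intro has_vector_derivative_diff) auto
    show "norm (w (\<gamma> u) - w (\<delta> u)) \<le> K * norm (\<gamma> u - \<delta> u) + 0"
    proof -
      have "\<gamma> u \<in> cball 0 r" "\<delta> u \<in> cball 0 r" using r u by auto
      from lipschitz_onD[OF K this] show ?thesis by (simp add: dist_norm)
    qed
  qed (use lipschitz_on_nonneg[OF K] in auto)
  then show ?thesis by (simp add: g d)
qed

text \<open>Uniqueness makes the definite description in \<open>flow\<close> proper, so any integral
  curve at hand computes the flow.\<close>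

lemma flow_eq_integral_curve:
  fixes w :: "'a::euclidean_space \<Rightarrow> 'a"
  assumes "lipschitz_inside_ball w R" "integral_curve w (ball 0 R) x I \<gamma>" "t \<in> I"
  shows "flow w (ball 0 R) t x = \<gamma> t"
  unfolding flow_def using assms integral_curve_unique by (intro the_equality) blast+

text \<open>A curve at distance 1 from its start at time \<open>t\<close> puts \<open>t\<close> into
  the index set of the infimum, and on the interval of the curve the flow may be replaced by the
  curve itself.\<close>

lemma unit_escape_length_le:
  fixes w :: "'a::euclidean_space \<Rightarrow> 'a"
  assumes lip: "lipschitz_inside_ball w R" and curve: "integral_curve w (ball 0 R) x I \<gamma>"
    and t: "t \<in> I" "norm (\<gamma> t - x) = 1"
  shows "unit_escape_length w (ball 0 R) x \<le> ereal \<bar>LBINT u=ereal 0..ereal t. norm (w (\<gamma> u))\<bar>"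
proof -
  let ?f = "\<lambda>s. flow w (ball 0 R) s x"
  note eq = flow_eq_integral_curve[OF lip curve]
  have I: "open I" "is_interval I" "0 \<in> I" using curve by (auto simp: integral_curve_def)
  \<comment> \<open>The flow is known to agree with \<open>\<gamma>\<close> only on
    \<open>I\<close>; as \<open>I\<close> is open, this determines the derivative.\<close>
  have vd: "vector_derivative ?f (at u) = w (\<gamma> u)" if "u \<in> I" for u
  proof (rule vector_derivative_at)
    have "(\<gamma> has_vector_derivative w (\<gamma> u)) (at u)" using curve that by (auto simp: integral_curve_def)
    then show "(?f has_vector_derivative w (\<gamma> u)) (at u)"
      by (rule has_vector_derivative_transform_within_open[OF _ I(1) that]) (simp add: eq)
  qed
  have "closed_segment 0 t \<subseteq> I"
    using I t by (simp add: closed_segment_subset is_interval_convex)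
  then have "flow_length w (ball 0 R) t x = \<bar>LBINT u=ereal 0..ereal t. norm (w (\<gamma> u))\<bar>"
    unfolding flow_length_def
    by (intro arg_cong[where f = abs] interval_integral_cong)
       (auto simp: closed_segment_eq_real_ivl einterval_def min_def max_def subset_iff vd split: if_splits)
  moreover have "t \<in> flow_times w (ball 0 R) x"
    using curve t by (auto simp: flow_times_def)
  ultimately show ?thesis
    unfolding unit_escape_length_def using t eq[OF t(1)]
    by (metis (mono_tags, lifting) INF_lower mem_Collect_eq)
qed

text \<open>Stopping at the first exit keeps the whole arc within distance 1 of its start. There an
  extended field still agrees with the original one, so the arc is an honest flow line.\<close>

lemma first_unit_exit:
  fixes X :: "real \<Rightarrow> 'a::real_normed_vector"
  assumes cont: "continuous_on UNIV X" and "1 \<le> norm (X t - X 0)"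
  obtains \<tau> where "\<tau> \<in> closed_segment 0 t" "norm (X \<tau> - X 0) = 1"
    "\<And>u. u \<in> closed_segment 0 \<tau> \<Longrightarrow> norm (X u - X 0) \<le> 1"
proof -
  define d where "d u = norm (X u - X 0)" for u
  have d: "continuous_on T d" for T
    unfolding d_def using continuous_on_subset[OF cont] by (auto intro!: continuous_intros)
  define A where "A = closed_segment 0 t \<inter> {u. 1 \<le> d u}"
  have "compact A" unfolding A_def
    by (intro compact_Int_closed compact_segment closed_Collect_le d continuous_intros)
  moreover have "A \<noteq> {}" using assms by (auto simp: A_def d_def)
  \<comment> \<open>Minimizing \<open>abs\<close> finds the first time of contact in either
    direction of time.\<close>
  ultimately obtain \<tau> where \<tau>: "\<tau> \<in> A" and min: "\<And>u. u \<in> A \<Longrightarrow> \<bar>\<tau>\<bar> \<le> \<bar>u\<bar>"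
    using continuous_attains_inf[of A abs] continuous_on_rabs[OF continuous_on_id] by blast
  have sub: "closed_segment 0 \<tau> \<subseteq> closed_segment 0 t"
    using \<tau> by (auto simp: A_def closed_segment_eq_real_ivl split: if_splits)
  have less: "d u < 1" if "u \<in> closed_segment 0 \<tau>" "u \<noteq> \<tau>" for u
  proof (rule ccontr)
    assume "\<not> d u < 1"
    then have "\<bar>\<tau>\<bar> \<le> \<bar>u\<bar>" using that sub by (intro min) (auto simp: A_def)
    then show False using that by (auto simp: closed_segment_eq_real_ivl split: if_splits)
  qed
  have "is_interval (d ` closed_segment 0 \<tau>)"
    using connected_continuous_image[OF d] by (simp add: is_interval_connected_1)
  moreover have "d 0 = 0" by (simp add: d_def)
  \<comment> \<open>By the intermediate value theorem the distance 1 is attained on the segment, and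
    by \<open>less\<close> this can happen only at its end \<open>\<tau>\<close>.\<close>
  ultimately have "1 \<in> d ` closed_segment 0 \<tau>"
    using mem_is_interval_1_I[of "d ` closed_segment 0 \<tau>" "d 0" "d \<tau>" 1] \<tau> by (auto simp: A_def)
  then have "d \<tau> = 1" using less by force
  then show thesis
    using that[of \<tau>] \<tau> less by (force simp: A_def d_def)
qed

text \<open>The connected component of 0 in the preimage of the ball is an open interval, as
  \<open>integral_curve\<close> demands, and on it the extended field \<open>w'\<close> is
  indistinguishable from \<open>w\<close>.\<close>

lemma integral_curve_of_global_solution:
  fixes X :: "real \<Rightarrow> 'a::real_normed_vector"
  assumes X: "\<And>t. (X has_vector_derivative w' (X t)) (at t)"
    and agree: "\<And>x. x \<in> ball 0 r \<Longrightarrow> w' x = w x" and "r \<le> R"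
    and stay: "\<And>u. u \<in> closed_segment 0 t \<Longrightarrow> X u \<in> ball 0 r"
  obtains I where "integral_curve w (ball 0 R) (X 0) I X" "closed_segment 0 t \<subseteq> I"
proof -
  define I where "I = connected_component_set (X -` ball 0 r) 0"
  have "continuous_on UNIV X"
    using X by (meson continuous_at_imp_continuous_on has_vector_derivative_continuous)
  then have "open (X -` ball 0 r)" by (simp add: open_vimage)
  then have "open I" unfolding I_def by (rule open_connected_component)
  moreover have "is_interval I"
    by (simp add: is_interval_connected_1 I_def)
  moreover have sub: "closed_segment 0 t \<subseteq> I"
    unfolding I_def using stay by (intro connected_component_maximal) auto
  moreover have "X u \<in> ball 0 r" if "u \<in> I" for u
    using that connected_component_subset unfolding I_def by fastforce
  ultimately have "integral_curve w (ball 0 R) (X 0) I X"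
    unfolding integral_curve_def using X agree[of "X u" for u] subset_ball[OF \<open>r \<le> R\<close>]
    by (metis ends_in_segment(1) subsetD)
  with sub show thesis using that by blast
qed

text \<open>Otherwise the arc up to the first exit would have length at most
  \<open>c * \<bar>t\<bar> < L\<close> and end at distance 1, against the lower bound on the escape
  length.\<close>

lemma stays_in_unit_ball:
  fixes X :: "real \<Rightarrow> 'a::euclidean_space"
  assumes lip: "lipschitz_inside_ball w R"
    and X: "\<And>t. (X has_vector_derivative w' (X t)) (at t)" and contw: "continuous_on UNIV w'"
    and agree: "\<And>x. x \<in> ball 0 r \<Longrightarrow> w' x = w x" and r: "norm (X 0) + 1 < r" "r \<le> R"
    and c: "\<And>x. norm (w' x) \<le> c"
    and L: "ereal L \<le> unit_escape_length w (ball 0 R) (X 0)"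
    and t: "c * \<bar>t\<bar> < L"
  shows "norm (X t - X 0) < 1"
proof (rule ccontr)
  assume exit: "\<not> ?thesis"
  have contX: "continuous_on UNIV X"
    using X by (meson continuous_at_imp_continuous_on has_vector_derivative_continuous)
  then obtain \<tau> where \<tau>: "\<tau> \<in> closed_segment 0 t" "norm (X \<tau> - X 0) = 1"
    and le: "\<And>u. u \<in> closed_segment 0 \<tau> \<Longrightarrow> norm (X u - X 0) \<le> 1"
    using first_unit_exit[OF contX, of t] exit by (auto simp: not_less)
  have stay: "X u \<in> ball 0 r" if "u \<in> closed_segment 0 \<tau>" for u
    using le[OF that] r norm_triangle_ineq2[of "X u" "X 0"] by auto
  obtain I where I: "integral_curve w (ball 0 R) (X 0) I X" "closed_segment 0 \<tau> \<subseteq> I"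
    using integral_curve_of_global_solution[of X w' r w R \<tau>, OF X agree r(2) stay] by blast
  have "continuous_on UNIV (\<lambda>u. norm (w' (X u)))"
    using continuous_on_compose2[OF contw contX] by (auto intro: continuous_intros)
  \<comment> \<open>An antiderivative of the speed turns the length into a difference, which the
    speed bound \<open>c\<close> controls.\<close>
  then obtain G where G: "\<And>u. (G has_vector_derivative norm (w' (X u))) (at u)"
    using antiderivative_UNIV by metis
  have "(LBINT u=ereal 0..ereal \<tau>. norm (w (X u))) = (LBINT u=ereal 0..ereal \<tau>. norm (w' (X u)))"
    using stay agree by (intro interval_integral_cong)
      (auto simp: closed_segment_eq_real_ivl einterval_def min_def max_def simp del: mem_ball split: if_splits)
  also have "\<dots> = G \<tau> - G 0"
    using G \<open>continuous_on UNIV (\<lambda>u. norm (w' (X u)))\<close>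
    by (intro interval_integral_FTC_finite) (auto intro: continuous_on_subset has_vector_derivative_at_within)
  finally have "\<bar>LBINT u=ereal 0..ereal \<tau>. norm (w (X u))\<bar> = norm (G \<tau> - G 0)" by simp
  also have "\<dots> \<le> c * norm (\<tau> - 0)"
    by (rule field_differentiable_bound[where S = UNIV and f' = "\<lambda>u. norm (w' (X u))"])
       (use G c in \<open>auto simp: has_real_derivative_iff_has_vector_derivative\<close>)
  also have "\<dots> \<le> c * \<bar>t\<bar>"
    using \<tau>(1) order_trans[OF norm_ge_zero c] by (intro mult_left_mono) (auto simp: closed_segment_eq_real_ivl split: if_splits)
  finally have "\<bar>LBINT u=ereal 0..ereal \<tau>. norm (w (X u))\<bar> < L" using t by simp
  moreover have "\<tau> \<in> I" using I(2) by auto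
  note unit_escape_length_le[OF lip I(1) this \<tau>(2)]
  then have "ereal L \<le> ereal \<bar>LBINT u=ereal 0..ereal \<tau>. norm (w (X u))\<bar>"
    using L by (rule order_trans[rotated])
  ultimately show False by simp
qed

section \<open>Stream functions\<close>

text \<open>The pointwise map behind \<open>perp\<close>, which acts on whole fields; in this form
  linearity and isometry can be stated.\<close>

definition rot90 :: "real^2 \<Rightarrow> real^2" where
  "rot90 u = vector [- (u $ 2), u $ 1]"

lemma rot90_nth [simp]: "rot90 u $ 1 = - (u $ 2)" "rot90 u $ 2 = u $ 1"
  by (simp_all add: rot90_def vector_2)

lemma inner_real2: "(u :: real^2) \<bullet> k = u $ 1 * k $ 1 + u $ 2 * k $ 2"
  by (simp add: inner_vec_def sum_2)

lemma linear_rot90: "linear rot90"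
  by (auto intro!: linearI simp: vec_eq_iff forall_2)

lemma norm_rot90 [simp]: "norm (rot90 u) = norm u"
  by (simp add: norm_eq_sqrt_inner inner_real2)

lemma perp_eq_rot90: "perp w p = rot90 (w p)"
  by (simp add: perp_def rot90_def)

text \<open>The Poincare lemma on a ball. The potential is the integral of
  \<open>w (t *\<^sub>R x) \<bullet> x\<close> over \<open>t\<close> from 0 to 1, differentiated
  under the integral sign.\<close>

lemma potential_on_ball:
  fixes w :: "'a::euclidean_space \<Rightarrow> 'a"
  assumes der: "\<And>x. x \<in> ball 0 R \<Longrightarrow> (w has_derivative D x) (at x)"
    and cont: "\<And>h. continuous_on (ball 0 R) (\<lambda>x. D x h)"
    and sym: "\<And>x h k. x \<in> ball 0 R \<Longrightarrow> D x h \<bullet> k = D x k \<bullet> h"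
  obtains \<psi> :: "'a \<Rightarrow> real" where "\<And>x. x \<in> ball 0 R \<Longrightarrow> (\<psi> has_derivative (\<lambda>h. w x \<bullet> h)) (at x)"
proof (rule that)
  fix x0 :: 'a assume x0: "x0 \<in> ball 0 R"
  let ?U = "ball (0::'a) R" and ?I = "cbox 0 (1::real)"
  have scale: "t *\<^sub>R x \<in> ?U" if "x \<in> ?U" "t \<in> ?I" for t x
  proof -
    have "\<bar>t\<bar> * norm x \<le> 1 * norm x" using that by (intro mult_right_mono) auto
    then show ?thesis using that by simp
  qed
  \<comment> \<open>The derivative of the integrand in \<open>x\<close>, packed as a bounded linear
    function because the Leibniz rule asks for one.\<close>
  define fx where "fx x t = Blinfun (\<lambda>h. D (t *\<^sub>R x) (t *\<^sub>R h) \<bullet> x + w (t *\<^sub>R x) \<bullet> h)" for x t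
  have lin: "bounded_linear (D (t *\<^sub>R x))" if "x \<in> ?U" "t \<in> ?I" for x t
    using der[OF scale[OF that]] by (rule has_derivative_bounded_linear)
  have fx: "blinfun_apply (fx x t) = (\<lambda>h. D (t *\<^sub>R x) (t *\<^sub>R h) \<bullet> x + w (t *\<^sub>R x) \<bullet> h)"
    if "x \<in> ?U" "t \<in> ?I" for x t
    unfolding fx_def
    by (intro bounded_linear_Blinfun_apply bounded_linear_add bounded_linear_inner_right
        bounded_linear_inner_left[THEN bounded_linear_compose]
        bounded_linear_compose[OF lin[OF that]] bounded_linear_scaleR_right)
  have contw: "continuous_on ?U w"
    using der by (intro continuous_at_imp_continuous_on) (blast intro: has_derivative_continuous)
  have deriv: "((\<lambda>x. integral ?I (\<lambda>t. w (t *\<^sub>R x) \<bullet> x)) has_derivative blinfun_apply (integral ?I (fx x0))) (at x0 within ?U)"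
  proof (rule leibniz_rule[OF _ _ _ x0 convex_ball])
    fix x t assume xt: "x \<in> ?U" "t \<in> ?I"
    have "((\<lambda>x. w (t *\<^sub>R x)) has_derivative (\<lambda>h. D (t *\<^sub>R x) (t *\<^sub>R h))) (at x)"
      using has_derivative_compose[OF has_derivative_scaleR_right[OF has_derivative_ident] der[OF scale[OF xt]]]
      by (simp add: o_def)
    then have "((\<lambda>x. w (t *\<^sub>R x) \<bullet> x) has_derivative (\<lambda>h. w (t *\<^sub>R x) \<bullet> h + D (t *\<^sub>R x) (t *\<^sub>R h) \<bullet> x)) (at x)"
      by (rule has_derivative_inner) (rule has_derivative_ident)
    then show "((\<lambda>x. w (t *\<^sub>R x) \<bullet> x) has_derivative blinfun_apply (fx x t)) (at x within ?U)"
      unfolding fx[OF xt] by (simp add: add.commute has_derivative_at_withinI)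
  next
    fix x assume x: "x \<in> ?U"
    have "continuous_on ?I (\<lambda>t. w (t *\<^sub>R x) \<bullet> x)"
      using scale[OF x] by (intro continuous_intros continuous_on_compose2[OF contw]) auto
    then show "(\<lambda>t. w (t *\<^sub>R x) \<bullet> x) integrable_on ?I" by (rule integrable_continuous)
  next
    \<comment> \<open>Continuity in operator norm is checked on basis vectors. Pulling the factor
      \<open>t\<close> out of \<open>D\<close> leaves \<open>D\<close> in a fixed direction, where
      \<open>cont\<close> applies.\<close>
    show "continuous_on (?U \<times> ?I) (\<lambda>(x, t). fx x t)"
      unfolding continuous_on_eq_continuous_within
    proof (intro ballI continuous_blinfun_componentwiseI1)
      fix z and i :: 'a assume z: "z \<in> ?U \<times> ?I"
      have "continuous_on (?U \<times> ?I) (\<lambda>z. snd z * (D (snd z *\<^sub>R fst z) i \<bullet> fst z) + w (snd z *\<^sub>R fst z) \<bullet> i)"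
        using scale
        by (intro continuous_intros continuous_on_compose2[OF contw] continuous_on_compose2[OF cont[of i]]) force+
      moreover have "blinfun_apply (fx (fst z) (snd z)) i
          = snd z * (D (snd z *\<^sub>R fst z) i \<bullet> fst z) + w (snd z *\<^sub>R fst z) \<bullet> i" if "z \<in> ?U \<times> ?I" for z
      proof -
        have z: "fst z \<in> ?U" "snd z \<in> ?I" using that by auto
        show ?thesis unfolding fx[OF z] linear_cmul[OF bounded_linear.linear[OF lin[OF z]]] by simp
      qed
      ultimately have "continuous_on (?U \<times> ?I) (\<lambda>z. blinfun_apply (fx (fst z) (snd z)) i)"
        by (metis (no_types, lifting) continuous_on_cong)
      then show "continuous (at z within ?U \<times> ?I) (\<lambda>x. blinfun_apply (case x of (x, t) \<Rightarrow> fx x t) i)"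
        using z by (auto simp: continuous_on_eq_continuous_within case_prod_beta)
    qed
  qed
  have grad: "blinfun_apply (integral ?I (fx x0)) h = w x0 \<bullet> h" for h
  proof -
    have "continuous_on ?I (fx x0)"
    proof (unfold continuous_on_eq_continuous_within, intro ballI continuous_blinfun_componentwiseI1)
      fix z and i :: 'a assume z: "z \<in> ?I"
      have "continuous_on ?I (\<lambda>t. D (t *\<^sub>R x0) i \<bullet> x0 * t + w (t *\<^sub>R x0) \<bullet> i)"
        using scale[OF x0]
        by (intro continuous_intros continuous_on_compose2[OF contw] continuous_on_compose2[OF cont[of i]]) auto
      moreover have "blinfun_apply (fx x0 t) i = D (t *\<^sub>R x0) i \<bullet> x0 * t + w (t *\<^sub>R x0) \<bullet> i" if "t \<in> ?I" for t
        unfolding fx[OF x0 that] linear_cmul[OF bounded_linear.linear[OF lin[OF x0 that]]] by simp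
      ultimately have "continuous_on ?I (\<lambda>t. blinfun_apply (fx x0 t) i)"
        by (metis (no_types, lifting) continuous_on_cong)
      then show "continuous (at z within ?I) (\<lambda>t. blinfun_apply (fx x0 t) i)"
        using z by (simp add: continuous_on_eq_continuous_within)
    qed
    then have "blinfun_apply (integral ?I (fx x0)) h = integral ?I (\<lambda>t. blinfun_apply (fx x0 t) h)"
      using integral_linear[OF integrable_continuous blinfun.bounded_linear_left[of h], of 0 1 "fx x0"]
      by (simp add: o_def)
    \<comment> \<open>After exchanging \<open>x0\<close> and \<open>h\<close> by the symmetry of
      \<open>D\<close>, the integrand is the derivative of
      \<open>t *\<^sub>R (w (t *\<^sub>R x0) \<bullet> h)\<close>.\<close>
    also have "((\<lambda>t. blinfun_apply (fx x0 t) h) has_integral (1 *\<^sub>R (w (1 *\<^sub>R x0) \<bullet> h) - 0 *\<^sub>R (w (0 *\<^sub>R x0) \<bullet> h))) {0..1}"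
    proof (rule fundamental_theorem_of_calculus)
      fix t :: real assume "t \<in> {0..1}"
      then have t: "t \<in> ?I" by simp
      note lin = bounded_linear.linear[OF lin[OF x0 t]]
      have "((\<lambda>t. w (t *\<^sub>R x0)) has_derivative (\<lambda>s. D (t *\<^sub>R x0) (s *\<^sub>R x0))) (at t)"
        using has_derivative_compose[OF has_derivative_scaleR_left[OF has_derivative_ident] der[OF scale[OF x0 t]]]
        by (simp add: o_def)
      then have "((\<lambda>t. w (t *\<^sub>R x0)) has_vector_derivative D (t *\<^sub>R x0) x0) (at t)"
        by (simp add: has_vector_derivative_def linear_cmul[OF lin])
      then have "((\<lambda>t. w (t *\<^sub>R x0) \<bullet> h) has_vector_derivative D (t *\<^sub>R x0) x0 \<bullet> h) (at t)"
        by (rule bounded_linear.has_vector_derivative[OF bounded_linear_inner_left])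
      then have "((\<lambda>t. t *\<^sub>R (w (t *\<^sub>R x0) \<bullet> h)) has_vector_derivative
          t *\<^sub>R (D (t *\<^sub>R x0) x0 \<bullet> h) + 1 *\<^sub>R (w (t *\<^sub>R x0) \<bullet> h)) (at t)"
        by (intro has_vector_derivative_scaleR DERIV_ident)
      moreover have "t *\<^sub>R (D (t *\<^sub>R x0) x0 \<bullet> h) + 1 *\<^sub>R (w (t *\<^sub>R x0) \<bullet> h) = blinfun_apply (fx x0 t) h"
        unfolding fx[OF x0 t] linear_cmul[OF lin] using sym[OF scale[OF x0 t], of x0 h] by simp
      ultimately show "((\<lambda>t. t *\<^sub>R (w (t *\<^sub>R x0) \<bullet> h)) has_vector_derivative blinfun_apply (fx x0 t) h) (at t within {0..1})"
        by (simp add: has_vector_derivative_at_within)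
    qed simp
    then have "integral ?I (\<lambda>t. blinfun_apply (fx x0 t) h) = w x0 \<bullet> h"
      by (simp add: integral_unique)
    finally show ?thesis .
  qed
  have "blinfun_apply (integral ?I (fx x0)) = (\<lambda>h. w x0 \<bullet> h)"
    by (rule ext) (rule grad)
  with deriv show "((\<lambda>x. integral ?I (\<lambda>t. w (t *\<^sub>R x) \<bullet> x)) has_derivative (\<lambda>h. w x0 \<bullet> h)) (at x0)"
    by (simp only: at_within_open[OF x0 open_ball])
qed

text \<open>Vanishing divergence of \<open>v\<close> is exactly symmetry of the Jacobian of the
  rotated field, so that field is a gradient on the ball.\<close>

lemma stream_function:
  fixes v :: "real^2 \<Rightarrow> real^2"
  assumes v: "Ck_on (Suc 0) v (ball 0 R)" and inc: "incompressible_on v (ball 0 R)"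
  obtains \<psi> :: "real^2 \<Rightarrow> real"
  where "\<And>x. x \<in> ball 0 R \<Longrightarrow> (\<psi> has_derivative (\<lambda>h. rot90 (v x) \<bullet> h)) (at x)"
proof -
  let ?D = "\<lambda>x. frechet_derivative v (at x)"
  have der: "(v has_derivative ?D x) (at x)" if "x \<in> ball 0 R" for x
    using v that by (simp add: frechet_derivative_works)
  have bl: "bounded_linear rot90" using linear_rot90 by (simp add: linear_conv_bounded_linear)
  show thesis
  proof (rule potential_on_ball[of R "\<lambda>x. rot90 (v x)" "\<lambda>x h. rot90 (?D x h)"])
    show "((\<lambda>x. rot90 (v x)) has_derivative (\<lambda>h. rot90 (?D x h))) (at x)" if "x \<in> ball 0 R" for x
      by (rule bounded_linear.has_derivative[OF bl der[OF that]])
    show "continuous_on (ball 0 R) (\<lambda>x. rot90 (?D x h))" for h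
      using v by (intro bounded_linear.continuous_on[OF bl]) simp
    show "rot90 (?D x h) \<bullet> k = rot90 (?D x k) \<bullet> h" if x: "x \<in> ball 0 R" for x h k
    proof -
      define a b where "a = ?D x (axis 1 1)" and "b = ?D x (axis 2 1)"
      have lin: "?D x h = h $ 1 *\<^sub>R a + h $ 2 *\<^sub>R b" for h
      proof -
        have h: "h $ 1 *\<^sub>R axis 1 1 + h $ 2 *\<^sub>R axis 2 1 = h"
          by (simp add: vec_eq_iff forall_2 axis_def)
        have "linear (?D x)" by (rule has_derivative_linear[OF der[OF x]])
        then have "?D x (h $ 1 *\<^sub>R axis 1 1 + h $ 2 *\<^sub>R axis 2 1) = h $ 1 *\<^sub>R a + h $ 2 *\<^sub>R b"
          unfolding a_def b_def by (simp only: linear_add linear_cmul)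
        then show ?thesis unfolding h .
      qed
      have "a $ 1 + b $ 2 = 0"
        using inc x by (simp add: incompressible_on_def divergence_def sum_2 a_def b_def)
      then have "b $ 2 = - a $ 1" by simp
      then show ?thesis by (simp add: lin inner_real2 algebra_simps)
    qed
  qed (rule that)
qed

section \<open>Absence of closed orbits\<close>

text \<open>A loop of least duration cannot contain a shorter one, so it is simple. The least
  duration exists because a nonvanishing field forces a positive lower bound on return
  times.\<close>

lemma minimal_loop:
  fixes X :: "real \<Rightarrow> 'a::euclidean_space"
  assumes "a < b" "X a = X b"
    and X: "\<And>t. t \<in> {a..b} \<Longrightarrow> (X has_vector_derivative w (X t)) (at t)"
    and contw: "continuous_on (X ` {a..b}) w" and nz: "\<And>t. t \<in> {a..b} \<Longrightarrow> w (X t) \<noteq> 0"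
  obtains p q where "a \<le> p" "p < q" "q \<le> b" "X p = X q"
    "\<And>s t. p \<le> s \<Longrightarrow> s < t \<Longrightarrow> t \<le> q \<Longrightarrow> X s = X t \<Longrightarrow> s = p \<and> t = q"
proof -
  let ?T = "{a..b}"
  have contX: "continuous_on ?T X"
    using X by (intro continuous_at_imp_continuous_on) (blast intro: has_vector_derivative_continuous)
  have contwX: "continuous_on ?T (\<lambda>t. w (X t))"
    using continuous_on_compose2[OF contw contX] by auto
  obtain c where c: "c > 0" "\<And>t. t \<in> ?T \<Longrightarrow> c \<le> norm (w (X t))"
  proof -
    obtain t0 where t0: "t0 \<in> ?T" "\<And>t. t \<in> ?T \<Longrightarrow> norm (w (X t0)) \<le> norm (w (X t))"
      using continuous_attains_inf[OF compact_Icc _ continuous_on_norm[OF contwX]] \<open>a < b\<close> by auto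
    then show thesis using nz[OF t0(1)] by (intro that[of "norm (w (X t0))"]) auto
  qed
  have "uniformly_continuous_on ?T (\<lambda>t. w (X t))"
    by (intro compact_uniformly_continuous contwX) auto
  then obtain \<delta> where \<delta>: "\<delta> > 0"
      "\<And>s t. s \<in> ?T \<Longrightarrow> t \<in> ?T \<Longrightarrow> dist t s < \<delta> \<Longrightarrow> dist (w (X t)) (w (X s)) < c"
    using c(1) unfolding uniformly_continuous_on_def by metis
  \<comment> \<open>By the mean value theorem an early return would produce a velocity orthogonal to
    the initial one. By Pythagoras the two would differ by at least \<open>c\<close>, while uniform
    continuity keeps them closer than that.\<close>
  have far: "\<delta> \<le> t - s" if st: "s \<in> ?T" "t \<in> ?T" "s < t" "X s = X t" for s t
  proof (rule ccontr)
    assume near: "\<not> ?thesis"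
    define g where "g u = X u \<bullet> w (X s)" for u
    have g: "(g has_real_derivative w (X u) \<bullet> w (X s)) (at u)" if "u \<in> ?T" for u
      unfolding g_def has_real_derivative_iff_has_vector_derivative
      by (rule bounded_linear.has_vector_derivative[OF bounded_linear_inner_left X[OF that]])
    have "\<exists>u>s. u < t \<and> g t - g s = (t - s) * (w (X u) \<bullet> w (X s))"
      by (rule MVT2[OF st(3) g]) (use st in auto)
    then obtain u where u: "s < u" "u < t" "g t - g s = (t - s) * (w (X u) \<bullet> w (X s))"
      by blast
    then have orth: "w (X u) \<bullet> w (X s) = 0" using st by (simp add: g_def)
    have "(dist (w (X u)) (w (X s)))\<^sup>2 = (norm (w (X u)))\<^sup>2 + (norm (w (X s)))\<^sup>2"
      using orth by (simp add: dist_norm power2_norm_eq_inner inner_diff inner_commute)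
    then have "norm (w (X s)) \<le> dist (w (X u)) (w (X s))"
      using power2_le_imp_le[of "norm (w (X s))" "dist (w (X u)) (w (X s))"] by simp
    moreover have "dist (w (X u)) (w (X s)) < c"
      using u st near by (intro \<delta>) (auto simp: dist_real_def)
    ultimately show False using c(2)[OF st(1)] by simp
  qed
  \<comment> \<open>Requiring the gap \<open>\<delta>\<close> instead of
    \<open>fst z < snd z\<close> excludes the diagonal by a closed condition, so \<open>P\<close> is
    compact.\<close>
  define P where "P = {z \<in> ?T \<times> ?T. X (fst z) = X (snd z) \<and> \<delta> \<le> snd z - fst z}"
  have "closed P"
  proof -
    have "continuous_on (?T \<times> ?T) (\<lambda>z. dist (X (fst z)) (X (snd z)))"
      by (intro continuous_intros continuous_on_compose2[OF contX]) auto
    then have "closed {z \<in> ?T \<times> ?T. dist (X (fst z)) (X (snd z)) \<le> 0}"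
      by (rule continuous_on_closed_Collect_le) (intro continuous_on_const closed_Times closed_atLeastAtMost)+
    moreover have "closed {z \<in> ?T \<times> ?T. \<delta> \<le> snd z - fst z}"
      by (rule continuous_on_closed_Collect_le) (intro continuous_intros closed_Times closed_atLeastAtMost)+
    ultimately have "closed ({z \<in> ?T \<times> ?T. dist (X (fst z)) (X (snd z)) \<le> 0} \<inter> {z \<in> ?T \<times> ?T. \<delta> \<le> snd z - fst z})"
      by (rule closed_Int)
    moreover have "{z \<in> ?T \<times> ?T. dist (X (fst z)) (X (snd z)) \<le> 0} \<inter> {z \<in> ?T \<times> ?T. \<delta> \<le> snd z - fst z} = P"
      by (auto simp: P_def)
    ultimately show ?thesis by simp
  qed
  moreover have "P \<subseteq> ?T \<times> ?T" by (auto simp: P_def)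
  ultimately have "compact P"
    using compact_Times[OF compact_Icc compact_Icc] by (metis compact_Int_closed inf.absorb_iff2)
  moreover have "(a, b) \<in> P" using assms far[of a b] by (auto simp: P_def)
  moreover have "continuous_on P (\<lambda>z. snd z - fst z)" by (intro continuous_intros)
  ultimately obtain z where z: "z \<in> P" "\<And>y. y \<in> P \<Longrightarrow> snd z - fst z \<le> snd y - fst y"
    using continuous_attains_inf[of P "\<lambda>z. snd z - fst z"] by blast
  show thesis
  proof (rule that[of "fst z" "snd z"])
    fix s t assume st: "fst z \<le> s" "s < t" "t \<le> snd z" "X s = X t"
    then have "s \<in> ?T" "t \<in> ?T" using z(1) by (auto simp: P_def)
    then have "(s, t) \<in> P" using st far by (auto simp: P_def)
    from z(2)[OF this] st show "s = fst z \<and> t = snd z" by simp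
  qed (use z \<delta> in \<open>auto simp: P_def\<close>)
qed

text \<open>Carries the orbit to \<open>complex\<close>, the setting of the Jordan curve theorem;
  being an isometry, it preserves balls around 0.\<close>

definition plane_of_complex :: "complex \<Rightarrow> real^2" where
  "plane_of_complex z = vector [Re z, Im z]"

lemma plane_of_complex_nth [simp]: "plane_of_complex z $ 1 = Re z" "plane_of_complex z $ 2 = Im z"
  by (simp_all add: plane_of_complex_def vector_2)

lemma norm_plane_of_complex [simp]: "norm (plane_of_complex z) = norm z"
  by (simp add: norm_vec_def L2_set_def sum_2 cmod_def)

lemma bounded_linear_plane_of_complex: "bounded_linear plane_of_complex"
  by (auto intro!: linearI simp: vec_eq_iff forall_2 linear_conv_bounded_linear[symmetric])

lemma plane_of_complex_inverse [simp]: "plane_of_complex (Complex (p $ 1) (p $ 2)) = p"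
  by (simp add: vec_eq_iff forall_2)

text \<open>A closed orbit bounds a region on which the stream function, being constant on the orbit, has
  an interior extremum, i.e. a zero of the field.\<close>

lemma no_closed_orbit:
  fixes w :: "real^2 \<Rightarrow> real^2"
  assumes "a < b" "X a = X b"
    and X: "\<And>t. t \<in> {a..b} \<Longrightarrow> (X has_vector_derivative w (X t)) (at t)"
    and ball: "\<And>t. t \<in> {a..b} \<Longrightarrow> X t \<in> ball 0 R"
    and contw: "continuous_on (ball 0 R) w" and nz: "\<And>x. x \<in> ball 0 R \<Longrightarrow> w x \<noteq> 0"
    and psi: "\<And>x. x \<in> ball 0 R \<Longrightarrow> (\<psi> has_derivative (\<lambda>h. rot90 (w x) \<bullet> h)) (at x)"
  shows False
proof -
  obtain p q where pq: "a \<le> p" "p < q" "q \<le> b" "X p = X q"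
      and simple: "\<And>s t. p \<le> s \<Longrightarrow> s < t \<Longrightarrow> t \<le> q \<Longrightarrow> X s = X t \<Longrightarrow> s = p \<and> t = q"
    using minimal_loop[OF assms(1,2) X continuous_on_subset[OF contw]] ball nz by (metis image_subsetI)
  \<comment> \<open>Rescales the minimal loop to the unit interval, over which paths are
    parametrized.\<close>
  define line where "line s = p + s * (q - p)" for s
  have line: "p \<le> line s" "line s \<le> q" "line s \<in> {a..b}" if "s \<in> {0..1}" for s
  proof -
    have "0 \<le> s * (q - p)" using that pq by simp
    moreover have "s * (q - p) \<le> 1 * (q - p)" using that pq by (intro mult_right_mono) auto
    then have "s * (q - p) \<le> q - p" by (simp only: mult_1)
    ultimately show "p \<le> line s" "line s \<le> q" "line s \<in> {a..b}"
      using pq unfolding line_def atLeastAtMost_iff by linarith+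
  qed
  define c where "c s = Complex (X (line s) $ 1) (X (line s) $ 2)" for s
  have c: "plane_of_complex (c s) = X (line s)" for s by (simp add: c_def)
  have contX: "continuous_on {a..b} X"
    using X by (intro continuous_at_imp_continuous_on) (blast intro: has_vector_derivative_continuous)
  have "simple_path c"
  proof
    show "path c"
    proof -
      have "continuous_on {0..1} (\<lambda>s. X (line s))"
        using line by (intro continuous_on_compose2[OF contX]) (auto simp: line_def intro!: continuous_intros)
      then show ?thesis unfolding path_def c_def Complex_eq by (intro continuous_intros)
    qed
    fix x y :: real assume xy: "0 \<le> x" "x < y" "y \<le> 1" "c x = c y"
    then have "X (line x) = X (line y)" using c by metis
    moreover have "line x < line y" using xy pq by (simp add: line_def)
    ultimately have "line x = p \<and> line y = q" using line xy by (intro simple) auto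
    then have "x * (q - p) = 0" "(y - 1) * (q - p) = 0" by (simp_all add: line_def algebra_simps)
    then show "x = 0 \<and> y = 1" using pq by simp
  qed
  moreover have "pathfinish c = pathstart c"
    using pq by (simp add: pathfinish_def pathstart_def c_def line_def)
  ultimately have J: "inside (path_image c) \<noteq> {}" "open (inside (path_image c))"
      "bounded (inside (path_image c))" "frontier (inside (path_image c)) = path_image c"
    using Jordan_inside_outside by auto
  let ?\<Omega> = "inside (path_image c)"
  have img: "path_image c \<subseteq> ball 0 R"
  proof
    fix z assume "z \<in> path_image c"
    then obtain s where "s \<in> {0..1}" "z = c s" by (auto simp: path_image_def)
    then have "plane_of_complex z \<in> ball 0 R" using c ball line by metis
    then show "z \<in> ball 0 R" by simp
  qed
  \<comment> \<open>The ball is convex, so its complement is its outside, which lies in the outside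
    of the curve. The region enclosed thus stays where \<open>\<psi>\<close> is
    differentiable.\<close>
  have "?\<Omega> \<subseteq> ball 0 R"
  proof -
    have "bounded (path_image c)" using img bounded_ball bounded_subset by blast
    moreover have "outside (ball (0::complex) R) \<subseteq> outside (path_image c)"
      by (rule outside_mono[OF img])
    moreover have "outside (ball (0::complex) R) = - ball 0 R"
      by (rule outside_convex) simp
    ultimately show ?thesis
      using inside_Int_outside[of "path_image c"] by blast
  qed
  moreover have cl: "closure ?\<Omega> = ?\<Omega> \<union> path_image c"
    using J by (metis closure_Un_frontier)
  ultimately have sub: "closure ?\<Omega> \<subseteq> ball 0 R" using img by auto
  define \<eta> where "\<eta> z = \<psi> (plane_of_complex z)" for z
  have chi: "(\<eta> has_derivative (\<lambda>h. rot90 (w (plane_of_complex z)) \<bullet> plane_of_complex h)) (at z)"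
    if "z \<in> ball 0 R" for z
    unfolding \<eta>_def
    by (rule has_derivative_compose[OF bounded_linear_imp_has_derivative[OF bounded_linear_plane_of_complex] psi])
       (use that in auto)
  have no_ext: False if z: "z \<in> ?\<Omega>" and ext: "(\<forall>y\<in>?\<Omega>. \<eta> y \<le> \<eta> z) \<or> (\<forall>y\<in>?\<Omega>. \<eta> z \<le> \<eta> y)" for z
  proof -
    have zb: "z \<in> ball 0 R" using z cl sub by auto
    have "(\<lambda>h. rot90 (w (plane_of_complex z)) \<bullet> plane_of_complex h) = (\<lambda>h. 0)"
      by (rule differential_zero_maxmin[OF z J(2) chi[OF zb] ext])
    \<comment> \<open>The vanishing differential is evaluated at the gradient vector itself.\<close>
    then have "rot90 (w (plane_of_complex z)) \<bullet> rot90 (w (plane_of_complex z)) = 0"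
      using plane_of_complex_inverse by metis
    then have "norm (w (plane_of_complex z)) = 0" by (metis inner_eq_zero_iff norm_rot90 norm_zero)
    then show False using nz[of "plane_of_complex z"] zb by simp
  qed
  have const: "\<eta> z = \<psi> (X p)" if z: "z \<in> path_image c" for z
  proof -
    obtain s where s: "s \<in> {0..1}" "z = c s" using z by (auto simp: path_image_def)
    have "\<psi> (X (line s)) = \<psi> (X p)"
    proof (rule has_derivative_zero_unique[of "{p..q}" "\<lambda>t. \<psi> (X t)"])
      fix t assume t: "t \<in> {p..q}"
      then have t: "t \<in> {a..b}" using pq by auto
      have "((\<lambda>t. \<psi> (X t)) has_derivative (\<lambda>h. rot90 (w (X t)) \<bullet> (h *\<^sub>R w (X t)))) (at t)"
        by (rule has_derivative_compose[OF X[OF t, unfolded has_vector_derivative_def] psi[OF ball[OF t]]])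
      moreover have "rot90 (w (X t)) \<bullet> w (X t) = 0" by (simp add: inner_real2)
      ultimately show "((\<lambda>t. \<psi> (X t)) has_derivative (\<lambda>h. 0)) (at t within {p..q})"
        by (simp add: has_derivative_at_withinI)
    qed (use line s pq in auto)
    then show ?thesis by (simp add: \<eta>_def c s)
  qed
  have comp: "compact (closure ?\<Omega>)" and ne: "closure ?\<Omega> \<noteq> {}" using J by auto
  have cont: "continuous_on (closure ?\<Omega>) \<eta>"
    using chi sub by (intro continuous_at_imp_continuous_on) (blast intro: has_derivative_continuous)
  obtain M where M: "M \<in> closure ?\<Omega>" "\<And>z. z \<in> closure ?\<Omega> \<Longrightarrow> \<eta> z \<le> \<eta> M"
    using continuous_attains_sup[OF comp ne cont] by blast
  obtain m where m: "m \<in> closure ?\<Omega>" "\<And>z. z \<in> closure ?\<Omega> \<Longrightarrow> \<eta> m \<le> \<eta> z"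
    using continuous_attains_inf[OF comp ne cont] by blast
  have "M \<in> path_image c" using no_ext[of M] M cl by auto
  moreover have "m \<in> path_image c" using no_ext[of m] m cl by auto
  ultimately have eq: "\<eta> M = \<eta> m" using const by simp
  \<comment> \<open>Maximum and minimum over the closure coincide, so \<open>\<eta>\<close> is
    constant on the region and every interior point is an extremum.\<close>
  obtain z where z: "z \<in> ?\<Omega>" using J by auto
  have "\<eta> y \<le> \<eta> z" if "y \<in> ?\<Omega>" for y
    using M(2)[of y] m(2)[of z] that z cl eq by simp
  then show False using no_ext[OF z] by blast
qed

section \<open>Differentiability of the flow\<close>

text \<open>Along the solution for \<open>s\<^sub>0\<close>, the variational equation with initial
  value \<open>b\<close> has a solution \<open>Jt\<close>. The error of the linear approximation in
  \<open>s\<close> obeys Gronwall with a source quadratic in the initial difference, so it is of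
  smaller order than \<open>s - s\<^sub>0\<close>, uniformly for
  \<open>\<bar>t\<bar> < T\<close>.\<close>

lemma flow_family_differentiable:
  fixes \<Phi> :: "real \<Rightarrow> real \<Rightarrow> 'a::euclidean_space"
  assumes lip: "\<And>x y. norm (w x - w y) \<le> K * norm (x - y)"
    and sol: "\<And>s t. (\<Phi> s has_vector_derivative w (\<Phi> s t)) (at t)"
    and init: "((\<lambda>s. \<Phi> s 0) has_vector_derivative b) (at s\<^sub>0)"
    and C: "closed C" "convex C"
    and A: "\<And>x. x \<in> C \<Longrightarrow> linear (A x)" "\<And>x h. x \<in> C \<Longrightarrow> norm (A x h) \<le> K * norm h"
      "\<And>h. continuous_on C (\<lambda>x. A x h)"
    and taylor: "\<And>x y. x \<in> C \<Longrightarrow> y \<in> C \<Longrightarrow> norm (w y - w x - A x (y - x)) \<le> Q * (norm (y - x))\<^sup>2"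
    and Q: "0 \<le> Q"
    and U: "open U" "s\<^sub>0 \<in> U" and stay: "\<And>s t. s \<in> U \<Longrightarrow> \<bar>t\<bar> < T \<Longrightarrow> \<Phi> s t \<in> C" and t0: "\<bar>t\<^sub>0\<bar> < T"
  obtains J where
    "((\<lambda>z. \<Phi> (fst z) (snd z)) has_derivative (\<lambda>h. fst h *\<^sub>R J + snd h *\<^sub>R w (\<Phi> s\<^sub>0 t\<^sub>0))) (at (s\<^sub>0, t\<^sub>0))"
proof -
  \<comment> \<open>The projection keeps the coefficient \<open>A\<close> of the variational
    equation defined and bounded at all times, as the global existence theorem requires; on
    \<open>C\<close> it is the identity.\<close>
  define P where "P = closest_point C"
  have ne: "C \<noteq> {}" using stay[OF U(2) t0] by auto
  have P: "P x \<in> C" "x \<in> C \<Longrightarrow> P x = x" for x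
    using closest_point_in_set[OF C(1) ne] by (auto simp: P_def closest_point_self)
  have contP: "continuous_on S P" for S
    unfolding P_def by (rule continuous_on_closest_point[OF C(2,1) ne])
  have K: "0 \<le> K"
  proof -
    obtain i :: 'a where "i \<in> Basis" using nonempty_Basis by blast
    then show ?thesis using order_trans[OF norm_ge_zero lip[of i 0]] by simp
  qed
  have cont0: "continuous_on UNIV (\<Phi> s\<^sub>0)"
    using sol by (meson continuous_at_imp_continuous_on has_vector_derivative_continuous)
  obtain Jt where Jt: "Jt 0 = b" "\<And>t. (Jt has_vector_derivative A (P (\<Phi> s\<^sub>0 t)) (Jt t)) (at t)"
  proof (rule Picard_Lindeloef_global[of "\<lambda>t y. A (P (\<Phi> s\<^sub>0 t)) y" K b "K * norm b"])
    have lin: "A (P (\<Phi> s\<^sub>0 t)) y = (\<Sum>i\<in>Basis. (y \<bullet> i) *\<^sub>R A (P (\<Phi> s\<^sub>0 t)) i)" for t y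
      by (subst euclidean_representation[of y, symmetric])
         (simp only: linear_sum[OF A(1)[OF P(1)]] linear_cmul[OF A(1)[OF P(1)]])
    have "continuous_on UNIV (\<lambda>z. A (P (\<Phi> s\<^sub>0 (fst z))) i)" for i
      by (intro continuous_on_compose2[OF A(3)] continuous_on_compose2[OF contP] continuous_on_compose2[OF cont0]
          continuous_on_fst continuous_on_id) (use P in auto)
    then have "continuous_on UNIV (\<lambda>z. \<Sum>i\<in>Basis. (snd z \<bullet> i) *\<^sub>R A (P (\<Phi> s\<^sub>0 (fst z))) i)"
      by (intro continuous_intros) auto
    then show "continuous_on UNIV (\<lambda>(t, y). A (P (\<Phi> s\<^sub>0 t)) y)"
      by (subst lin) (simp add: case_prod_beta)
    show "norm (A (P (\<Phi> s\<^sub>0 t)) x - A (P (\<Phi> s\<^sub>0 t)) y) \<le> K * norm (x - y)" for t x y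
      using A(2)[OF P(1), of _ "x - y"] by (simp only: linear_diff[OF A(1)[OF P(1)]])
    show "norm (A (P (\<Phi> s\<^sub>0 t)) b) \<le> K * norm b" for t by (rule A(2)[OF P(1)])
  qed (rule that)
  define E where "E = exp ((K + 1) * T)"
  have E: "1 \<le> E" using K t0 by (simp add: E_def)
  have expE: "exp ((K + 1) * \<bar>t\<bar>) \<le> E" if "\<bar>t\<bar> < T" for t
    unfolding E_def using that K by (auto intro!: mult_left_mono)
  define D where "D s t = \<Phi> s t - \<Phi> s\<^sub>0 t" for s t
  define e where "e s t = D s t - (s - s\<^sub>0) *\<^sub>R Jt t" for s t
  have derD: "(D s has_vector_derivative w (\<Phi> s t) - w (\<Phi> s\<^sub>0 t)) (at t)" for s t
    unfolding D_def by (intro has_vector_derivative_diff sol)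
  have D_le: "norm (D s t) \<le> norm (D s 0) * E" if "\<bar>t\<bar> < T" for s t
  proof -
    have "norm (D s t) \<le> (norm (D s 0) + 0) * exp ((K + 1) * \<bar>t\<bar>)"
      using K lip by (intro gronwall[OF _ _ derD]) (auto simp: D_def)
    also have "\<dots> \<le> (norm (D s 0) + 0) * E"
      by (intro mult_left_mono expE that) auto
    finally show ?thesis by simp
  qed
  have e_le: "norm (e s t) \<le> (norm (e s 0) + Q * (norm (D s 0) * E)\<^sup>2) * E" if s: "s \<in> U" and t: "\<bar>t\<bar> < T" for s t
  proof -
    have "norm (e s t) \<le> (norm (e s 0) + Q * (norm (D s 0) * E)\<^sup>2) * exp ((K + 1) * \<bar>t\<bar>)"
    proof (rule gronwall[where e' = "\<lambda>u. w (\<Phi> s u) - w (\<Phi> s\<^sub>0 u) - (s - s\<^sub>0) *\<^sub>R A (P (\<Phi> s\<^sub>0 u)) (Jt u)"])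
      fix u assume "u \<in> closed_segment 0 t"
      then have u: "\<bar>u\<bar> < T" using t by (auto simp: closed_segment_eq_real_ivl split: if_splits)
      show "(e s has_vector_derivative w (\<Phi> s u) - w (\<Phi> s\<^sub>0 u) - (s - s\<^sub>0) *\<^sub>R A (P (\<Phi> s\<^sub>0 u)) (Jt u)) (at u)"
        unfolding e_def
        by (intro has_vector_derivative_diff derD bounded_linear.has_vector_derivative[OF bounded_linear_scaleR_right] Jt)
      have in_C: "\<Phi> s u \<in> C" "\<Phi> s\<^sub>0 u \<in> C" using stay s U(2) u by auto
      note lin = A(1)[OF in_C(2)]
      \<comment> \<open>The derivative of the error splits into a Taylor remainder, quadratic in
        \<open>D s u\<close>, and the linearized field applied to the error itself.\<close>
      have "w (\<Phi> s u) - w (\<Phi> s\<^sub>0 u) - (s - s\<^sub>0) *\<^sub>R A (P (\<Phi> s\<^sub>0 u)) (Jt u)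
          = (w (\<Phi> s u) - w (\<Phi> s\<^sub>0 u) - A (\<Phi> s\<^sub>0 u) (D s u)) + A (\<Phi> s\<^sub>0 u) (e s u)"
        by (simp add: P in_C e_def linear_diff[OF lin] linear_cmul[OF lin])
      also have "norm \<dots> \<le> Q * (norm (D s u))\<^sup>2 + K * norm (e s u)"
        unfolding D_def by (intro norm_triangle_mono taylor in_C A)
      also have "\<dots> \<le> Q * (norm (D s 0) * E)\<^sup>2 + K * norm (e s u)"
        using D_le[OF u, of s] Q by (intro add_right_mono mult_left_mono power_mono) auto
      finally show "norm (w (\<Phi> s u) - w (\<Phi> s\<^sub>0 u) - (s - s\<^sub>0) *\<^sub>R A (P (\<Phi> s\<^sub>0 u)) (Jt u))
          \<le> K * norm (e s u) + Q * (norm (D s 0) * E)\<^sup>2" by simp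
    qed (use K Q in auto)
    also have "\<dots> \<le> (norm (e s 0) + Q * (norm (D s 0) * E)\<^sup>2) * E"
      using Q by (intro mult_left_mono expE t) auto
    finally show ?thesis .
  qed
  have e_deriv: "((\<lambda>z. e (fst z) (snd z)) has_derivative (\<lambda>h. 0)) (at (s\<^sub>0, t\<^sub>0))"
    unfolding has_derivative_at_alt
  proof (intro conjI allI impI bounded_linear_zero)
    fix \<epsilon> :: real assume \<epsilon>: "\<epsilon> > 0"
    \<comment> \<open>Differentiability of the initial curve, rephrased: \<open>e s 0\<close> is of
      smaller order than \<open>s - s\<^sub>0\<close>.\<close>
    have init': "\<exists>d>0. \<forall>s. norm (s - s\<^sub>0) < d \<longrightarrow> norm (e s 0) \<le> \<eta> * norm (s - s\<^sub>0)" if "\<eta> > 0" for \<eta>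
      using init that unfolding has_vector_derivative_def has_derivative_at_alt e_def D_def by (simp add: Jt)
    obtain d1 where d1: "d1 > 0" "\<And>s. norm (s - s\<^sub>0) < d1 \<Longrightarrow> norm (e s 0) \<le> \<epsilon> / (2 * E) * norm (s - s\<^sub>0)"
      using init'[of "\<epsilon> / (2 * E)"] \<epsilon> E by auto
    obtain d2 where d2: "d2 > 0" "\<And>s. norm (s - s\<^sub>0) < d2 \<Longrightarrow> norm (e s 0) \<le> 1 * norm (s - s\<^sub>0)"
      using init'[of 1] by auto
    obtain d3 where d3: "d3 > 0" "ball s\<^sub>0 d3 \<subseteq> U" using U by (meson openE)
    define m where "m = norm b + 1"
    have m: "m > 0" by (simp add: m_def add_nonneg_pos)
    have D0: "norm (D s 0) \<le> m * norm (s - s\<^sub>0)" if "norm (s - s\<^sub>0) < d2" for s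
    proof -
      have "norm (D s 0) \<le> norm (e s 0) + norm ((s - s\<^sub>0) *\<^sub>R b)"
        using norm_triangle_ineq[of "e s 0" "(s - s\<^sub>0) *\<^sub>R b"] by (simp add: e_def Jt)
      moreover have "norm ((s - s\<^sub>0) *\<^sub>R b) = norm b * norm (s - s\<^sub>0)" by simp
      ultimately show ?thesis using d2(2)[OF that] unfolding m_def distrib_right by linarith
    qed
    define q where "q = Q + 1"
    have q: "q > 0" "Q \<le> q" using Q by (simp_all add: q_def)
    \<comment> \<open>Chosen so that the quadratic source, after the factor \<open>E\<close> from
      Gronwall, uses at most half of \<open>\<epsilon>\<close>; the initial error uses the other
      half.\<close>
    define d4 where "d4 = \<epsilon> / (2 * q * m\<^sup>2 * E ^ 3)"
    have d4: "d4 > 0" using \<epsilon> q m E by (simp add: d4_def)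
    define d where "d = min (min d1 d2) (min (min d3 d4) (T - \<bar>t\<^sub>0\<bar>))"
    have "norm (e (fst z) (snd z)) \<le> \<epsilon> * norm (z - (s\<^sub>0, t\<^sub>0))" if z: "norm (z - (s\<^sub>0, t\<^sub>0)) < d" for z
    proof -
      define s t where "s = fst z" and "t = snd z"
      have st: "\<bar>s - s\<^sub>0\<bar> \<le> norm (z - (s\<^sub>0, t\<^sub>0))" "\<bar>t - t\<^sub>0\<bar> \<le> norm (z - (s\<^sub>0, t\<^sub>0))"
        using norm_fst_le[of "s - s\<^sub>0" "t - t\<^sub>0"] norm_snd_le[of "t - t\<^sub>0" "s - s\<^sub>0"]
        by (cases z; simp add: s_def t_def)+
      have s: "\<bar>s - s\<^sub>0\<bar> < d1" "\<bar>s - s\<^sub>0\<bar> < d2" "\<bar>s - s\<^sub>0\<bar> < d3" "\<bar>s - s\<^sub>0\<bar> \<le> d4" and t: "\<bar>t\<bar> < T"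
        using st z by (auto simp: d_def)
      have "s \<in> U" using s d3 by (auto simp: dist_real_def)
      have "(norm (D s 0) * E)\<^sup>2 \<le> (m * \<bar>s - s\<^sub>0\<bar> * E)\<^sup>2"
        using D0[of s] s E by (intro power_mono mult_right_mono) auto
      then have "Q * (norm (D s 0) * E)\<^sup>2 \<le> q * (m * \<bar>s - s\<^sub>0\<bar> * E)\<^sup>2"
        using q by (intro mult_mono) auto
      also have "\<dots> = q * m\<^sup>2 * E\<^sup>2 * \<bar>s - s\<^sub>0\<bar> * \<bar>s - s\<^sub>0\<bar>"
        by (simp add: power2_eq_square)
      also have "\<dots> \<le> q * m\<^sup>2 * E\<^sup>2 * d4 * \<bar>s - s\<^sub>0\<bar>"
        using s q by (intro mult_right_mono mult_left_mono) auto
      also have "\<dots> = \<epsilon> / (2 * E) * \<bar>s - s\<^sub>0\<bar>"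
        using E m q by (simp add: d4_def field_simps power2_eq_square power3_eq_cube)
      finally have "Q * (norm (D s 0) * E)\<^sup>2 \<le> \<epsilon> / (2 * E) * \<bar>s - s\<^sub>0\<bar>" .
      moreover have "norm (e s 0) \<le> \<epsilon> / (2 * E) * \<bar>s - s\<^sub>0\<bar>" using d1(2)[of s] s by simp
      ultimately have "(norm (e s 0) + Q * (norm (D s 0) * E)\<^sup>2) * E
          \<le> (\<epsilon> / (2 * E) * \<bar>s - s\<^sub>0\<bar> + \<epsilon> / (2 * E) * \<bar>s - s\<^sub>0\<bar>) * E"
        using E by (intro mult_right_mono add_mono) auto
      also have "\<dots> = \<epsilon> * \<bar>s - s\<^sub>0\<bar>" using E by (simp add: field_simps)
      also have "\<dots> \<le> \<epsilon> * norm (z - (s\<^sub>0, t\<^sub>0))" using st \<epsilon> by (intro mult_left_mono) auto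
      finally show ?thesis using e_le[OF \<open>s \<in> U\<close> t] by (simp add: s_def t_def)
    qed
    moreover have "d > 0" using d1 d2 d3 d4 t0 by (simp add: d_def)
    ultimately show "\<exists>d>0. \<forall>z. norm (z - (s\<^sub>0, t\<^sub>0)) < d \<longrightarrow>
        norm (e (fst z) (snd z) - e (fst (s\<^sub>0, t\<^sub>0)) (snd (s\<^sub>0, t\<^sub>0)) - 0) \<le> \<epsilon> * norm (z - (s\<^sub>0, t\<^sub>0))"
      by (intro exI[of _ d]) (auto simp: e_def D_def)
  qed
  \<comment> \<open>The product rule leaves one term only, as the factor
    \<open>fst z - s\<^sub>0\<close> vanishes at the base point.\<close>
  have "((\<lambda>z. (fst z - s\<^sub>0) *\<^sub>R Jt (snd z)) has_derivative (\<lambda>h. fst h *\<^sub>R Jt t\<^sub>0)) (at (s\<^sub>0, t\<^sub>0))"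
  proof -
    have "((\<lambda>z. Jt (snd z)) has_derivative (\<lambda>h. snd h *\<^sub>R A (P (\<Phi> s\<^sub>0 t\<^sub>0)) (Jt t\<^sub>0))) (at (s\<^sub>0, t\<^sub>0))"
      using has_derivative_compose[OF has_derivative_snd[OF has_derivative_ident] Jt(2)[unfolded has_vector_derivative_def], where x = "(s\<^sub>0, t\<^sub>0)" and s = UNIV]
      by simp
    from has_derivative_scaleR[OF has_derivative_diff[OF has_derivative_fst[OF has_derivative_ident] has_derivative_const[of s\<^sub>0]] this]
    show ?thesis by simp
  qed
  moreover have "((\<lambda>z. \<Phi> s\<^sub>0 (snd z)) has_derivative (\<lambda>h. snd h *\<^sub>R w (\<Phi> s\<^sub>0 t\<^sub>0))) (at (s\<^sub>0, t\<^sub>0))"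
    using has_derivative_compose[OF has_derivative_snd[OF has_derivative_ident] sol[unfolded has_vector_derivative_def], where x = "(s\<^sub>0, t\<^sub>0)" and s = UNIV]
    by simp
  ultimately have "((\<lambda>z. e (fst z) (snd z) + (fst z - s\<^sub>0) *\<^sub>R Jt (snd z) + \<Phi> s\<^sub>0 (snd z)) has_derivative
      (\<lambda>h. 0 + fst h *\<^sub>R Jt t\<^sub>0 + snd h *\<^sub>R w (\<Phi> s\<^sub>0 t\<^sub>0))) (at (s\<^sub>0, t\<^sub>0))"
    by (intro has_derivative_add e_deriv)
  moreover have "e s t + (s - s\<^sub>0) *\<^sub>R Jt t + \<Phi> s\<^sub>0 t = \<Phi> s t" for s t
    by (simp add: e_def D_def)
  ultimately show thesis by (intro that[of "Jt t\<^sub>0"]) simp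
qed

text \<open>Projection to the ball is nonexpansive, so the Lipschitz constant survives. The
  extension takes no new values, so bounds on the speed survive too, and solutions become
  global.\<close>

lemma lipschitz_cball_extension:
  fixes w :: "'a::euclidean_space \<Rightarrow> 'b::real_normed_vector"
  assumes "0 \<le> r" and w: "K-lipschitz_on (cball 0 r) w"
  defines "w' \<equiv> \<lambda>x. w (closest_point (cball 0 r) x)"
  shows "K-lipschitz_on UNIV w'" "\<And>x. x \<in> cball 0 r \<Longrightarrow> w' x = w x" "\<And>x. w' x \<in> w ` cball 0 r"
proof -
  have C: "convex (cball (0::'a) r)" "closed (cball (0::'a) r)" "cball (0::'a) r \<noteq> {}" using \<open>0 \<le> r\<close> by auto
  note in_C = closest_point_in_set[OF C(2,3)]
  show "K-lipschitz_on UNIV w'"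
  proof (rule lipschitz_onI)
    show "dist (w' x) (w' y) \<le> K * dist x y" for x y
    proof -
      have "dist (w' x) (w' y) \<le> K * dist (closest_point (cball 0 r) x) (closest_point (cball 0 r) y)"
        unfolding w'_def by (rule lipschitz_onD[OF w in_C in_C])
      also have "\<dots> \<le> K * dist x y"
        by (intro mult_left_mono closest_point_lipschitz C lipschitz_on_nonneg[OF w])
      finally show ?thesis .
    qed
  qed (rule lipschitz_on_nonneg[OF w])
qed (use closest_point_in_set[of "cball (0::'a) r"] \<open>0 \<le> r\<close> in \<open>auto simp: w'_def closest_point_self\<close>)

section \<open>The area estimate\<close>

text \<open>The change of variables formula gives the area of the injective image of a box with
  sides \<open>2 * M\<close> and \<open>2 * T\<close>. \<open>\<Phi>\<close> is driven by the
  globally defined \<open>w\<close>, but for the parameters in the box \<open>stay\<close> confines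
  it to the disk where \<open>w\<close> is \<open>v\<close>.\<close>

lemma area_swept_by_flow:
  fixes v w :: "real^2 \<Rightarrow> real^2" and \<Phi> :: "real \<Rightarrow> real \<Rightarrow> real^2"
  assumes v: "Ck_on (Suc (Suc 0)) v (ball 0 R)" and inc: "incompressible_on v (ball 0 R)"
    and c: "0 < c" "\<And>x. x \<in> ball 0 R \<Longrightarrow> c \<le> norm (v x)" and "r < R"
    and w: "K-lipschitz_on UNIV w" "\<And>x. x \<in> cball 0 r \<Longrightarrow> w x = v x"
    and sol: "\<And>s t. (\<Phi> s has_vector_derivative w (\<Phi> s t)) (at t)"
    and init: "\<And>s. \<bar>s\<bar> < M \<Longrightarrow>
      ((\<lambda>s. \<Phi> s 0) has_vector_derivative rot90 (v (\<Phi> s 0)) /\<^sub>R norm (v (\<Phi> s 0))) (at s)"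
    and stay: "\<And>s t. \<bar>s\<bar> < M \<Longrightarrow> \<bar>t\<bar> < T \<Longrightarrow> \<Phi> s t \<in> cball 0 r"
    and pos: "0 < M" "0 < T"
  shows "c * (4 * M * T) \<le> measure lebesgue (cball (0::real^2) r)"
proof -
  let ?C = "cball (0::real^2) r" and ?A = "\<lambda>x. frechet_derivative v (at x)"
  have sub: "?C \<subseteq> ball 0 R" using \<open>r < R\<close> by auto
  have v1: "Ck_on (Suc 0) v (ball 0 R)" using v by (rule Ck_on_Suc_imp)
  have derv: "(v has_derivative ?A x) (at x)" if "x \<in> ball 0 R" for x
    using v that by (simp add: frechet_derivative_works)
  have contv: "continuous_on S v" if "S \<subseteq> ball 0 R" for S
    using derv that by (intro continuous_at_imp_continuous_on) (blast intro: has_derivative_continuous)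
  obtain K0 where K0: "0 \<le> K0" "\<And>x h. x \<in> ?C \<Longrightarrow> norm (?A x h) \<le> K0 * norm h"
    using C1_lipschitz[OF v1 compact_cball convex_cball sub] by metis
  obtain Q where Q: "0 \<le> Q" "\<And>x y. x \<in> ?C \<Longrightarrow> y \<in> ?C \<Longrightarrow> norm (v y - v x - ?A x (y - x)) \<le> Q * (norm (y - x))\<^sup>2"
    using C2_taylor[OF v compact_cball convex_cball sub] by metis
  obtain \<psi> where psi: "\<And>x. x \<in> ball 0 R \<Longrightarrow> (\<psi> has_derivative (\<lambda>h. rot90 (v x) \<bullet> h)) (at x)"
    using stream_function[OF v1 inc] by metis
  have nz: "v x \<noteq> 0" if "x \<in> ball 0 R" for x using c(1) c(2)[OF that] by auto
  define S :: "(real^2) set" where "S = box (vector [-M, -T]) (vector [M, T])"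
  have S: "z \<in> S \<longleftrightarrow> \<bar>z $ 1\<bar> < M \<and> \<bar>z $ 2\<bar> < T" for z
    by (auto simp: S_def mem_box_cart forall_2 vector_2)
  define F where "F z = \<Phi> (z $ 1) (z $ 2)" for z :: "real^2"
  have FC: "F z \<in> ?C" and FR: "F z \<in> ball 0 R" if "z \<in> S" for z
    using stay that sub unfolding F_def S by blast+
  have solv: "(\<Phi> s has_vector_derivative v (\<Phi> s t)) (at t)" if "\<bar>s\<bar> < M" "\<bar>t\<bar> < T" for s t
    using sol[of s t] w(2)[OF stay[OF that]] by simp
  have init_ball: "\<Phi> s 0 \<in> ball 0 R" if "\<bar>s\<bar> < M" for s
    using stay[OF that, of 0] pos sub by auto
  \<comment> \<open>The gradient of \<open>\<psi>\<close> is the rotated field, and the initial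
    curve follows it with unit speed; so \<open>\<psi>\<close> grows along it at rate
    \<open>norm v\<close>.\<close>
  have psi_init: "((\<lambda>s. \<psi> (\<Phi> s 0)) has_derivative (\<lambda>h. h * norm (v (\<Phi> s 0)))) (at s)" if "\<bar>s\<bar> < M" for s
  proof -
    have "((\<lambda>s. \<psi> (\<Phi> s 0)) has_derivative
        (\<lambda>h. rot90 (v (\<Phi> s 0)) \<bullet> (h *\<^sub>R (rot90 (v (\<Phi> s 0)) /\<^sub>R norm (v (\<Phi> s 0)))))) (at s)"
      by (rule has_derivative_compose[OF init[OF that, unfolded has_vector_derivative_def] psi[OF init_ball[OF that]]])
    moreover
    have "rot90 (v (\<Phi> s 0)) \<bullet> rot90 (v (\<Phi> s 0)) = norm (v (\<Phi> s 0)) * norm (v (\<Phi> s 0))"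
      by (metis norm_rot90 power2_eq_square power2_norm_eq_inner)
    then have "rot90 (v (\<Phi> s 0)) \<bullet> (h *\<^sub>R (rot90 (v (\<Phi> s 0)) /\<^sub>R norm (v (\<Phi> s 0)))) = h * norm (v (\<Phi> s 0))" for h
      using nz[OF init_ball[OF that]] by (simp add: field_simps)
    ultimately show ?thesis by (simp only:)
  qed
  have psi_flow: "\<psi> (\<Phi> s t) = \<psi> (\<Phi> s 0)" if s: "\<bar>s\<bar> < M" and t: "\<bar>t\<bar> < T" for s t
  proof (rule has_derivative_zero_unique[of "{-T<..<T}" "\<lambda>t. \<psi> (\<Phi> s t)"])
    fix u assume "u \<in> {-T<..<T}"
    then have u: "\<bar>u\<bar> < T" by auto
    have "((\<lambda>t. \<psi> (\<Phi> s t)) has_derivative (\<lambda>h. rot90 (v (\<Phi> s u)) \<bullet> (h *\<^sub>R v (\<Phi> s u)))) (at u)"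
      using stay[OF s u] sub
      by (intro has_derivative_compose[OF solv[OF s u, unfolded has_vector_derivative_def] psi]) auto
    moreover have "rot90 (v (\<Phi> s u)) \<bullet> v (\<Phi> s u) = 0" by (simp add: inner_real2)
    ultimately show "((\<lambda>t. \<psi> (\<Phi> s t)) has_derivative (\<lambda>h. 0)) (at u within {-T<..<T})"
      by (simp add: has_derivative_at_withinI)
  qed (use t pos in auto)
  have "open S" unfolding S_def by (rule open_box)
  have F': "(F has_derivative frechet_derivative F (at z)) (at z)"
    and det: "\<bar>det (matrix (frechet_derivative F (at z)))\<bar> = norm (v (\<Phi> (z $ 1) 0))" if z: "z \<in> S" for z
  proof -
    have z1: "\<bar>z $ 1\<bar> < M" and z2: "\<bar>z $ 2\<bar> < T" using z S by auto
    obtain J where J: "((\<lambda>y. \<Phi> (fst y) (snd y)) has_derivative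
        (\<lambda>h. fst h *\<^sub>R J + snd h *\<^sub>R w (\<Phi> (z $ 1) (z $ 2)))) (at (z $ 1, z $ 2))"
    \<comment> \<open>One constant has to serve both as Lipschitz constant of \<open>w\<close> and
      as bound on the derivative of \<open>v\<close>, hence the maximum.\<close>
    proof (rule flow_family_differentiable[of w "max K K0" \<Phi> _ "z $ 1" ?C ?A Q "{-M<..<M}" T "z $ 2"])
      show "norm (w x - w y) \<le> max K K0 * norm (x - y)" for x y
        using lipschitz_onD[OF w(1), of x y] mult_right_mono[of K "max K K0" "norm (x - y)"]
        by (simp add: dist_norm)
      show "norm (?A x h) \<le> max K K0 * norm h" if "x \<in> ?C" for x h
        using K0(2)[OF that, of h] mult_right_mono[of K0 "max K K0" "norm h"] by simp
      show "continuous_on ?C (\<lambda>x. ?A x h)" for h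
        using v1 sub by (auto intro: continuous_on_subset)
      show "linear (?A x)" if "x \<in> ?C" for x
        using derv sub that has_derivative_linear by blast
      show "norm (w y - w x - ?A x (y - x)) \<le> Q * (norm (y - x))\<^sup>2" if "x \<in> ?C" "y \<in> ?C" for x y
        using Q(2)[OF that] w(2) that by simp
    qed (use sol init[OF z1] z1 z2 stay Q in \<open>auto simp del: mem_cball\<close>)
    have "((\<lambda>y. (y $ 1, y $ 2)) has_derivative (\<lambda>h. (h $ 1, h $ 2))) (at z)"
      by (intro has_derivative_Pair bounded_linear_imp_has_derivative bounded_linear_vec_nth)
    from has_derivative_compose[OF this J]
    have der: "(F has_derivative (\<lambda>h. h $ 1 *\<^sub>R J + h $ 2 *\<^sub>R v (F z))) (at z)"
      using w(2)[OF FC[OF z]] by (simp add: F_def[abs_def])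
    then show "(F has_derivative frechet_derivative F (at z)) (at z)"
      using frechet_derivative_works differentiable_def by blast
    \<comment> \<open>The vector \<open>J\<close> is known only to exist. Differentiating
      \<open>\<psi>\<close> along \<open>F\<close> in two ways determines its component along the
      rotated field, and the determinant sees just that component, since the second column is
      \<open>v (F z)\<close>.\<close>
    have "((\<lambda>y. \<psi> (F y)) has_derivative (\<lambda>h. rot90 (v (F z)) \<bullet> (h $ 1 *\<^sub>R J + h $ 2 *\<^sub>R v (F z)))) (at z)"
      by (rule has_derivative_compose[OF der psi[OF FR[OF z]]])
    moreover have "((\<lambda>y. \<psi> (F y)) has_derivative (\<lambda>h. h $ 1 * norm (v (\<Phi> (z $ 1) 0)))) (at z)"
    proof (rule has_derivative_transform_within_open[OF _ \<open>open S\<close> z])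
      show "((\<lambda>y. \<psi> (\<Phi> (y $ 1) 0)) has_derivative (\<lambda>h. h $ 1 * norm (v (\<Phi> (z $ 1) 0)))) (at z)"
        using has_derivative_compose[OF bounded_linear_imp_has_derivative[OF bounded_linear_vec_nth] psi_init[OF z1]]
        by simp
      show "\<psi> (\<Phi> (y $ 1) 0) = \<psi> (F y)" if "y \<in> S" for y
        using psi_flow that by (simp add: F_def S)
    qed
    ultimately have "(\<lambda>h::real^2. rot90 (v (F z)) \<bullet> (h $ 1 *\<^sub>R J + h $ 2 *\<^sub>R v (F z))) = (\<lambda>h. h $ 1 * norm (v (\<Phi> (z $ 1) 0)))"
      by (rule has_derivative_unique)
    from fun_cong[OF this, of "axis 1 1"] have "rot90 (v (F z)) \<bullet> J = norm (v (\<Phi> (z $ 1) 0))"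
      by (simp add: axis_def)
    moreover have "det (matrix (\<lambda>h::real^2. h $ 1 *\<^sub>R J + h $ 2 *\<^sub>R v (F z))) = - (rot90 (v (F z)) \<bullet> J)"
      by (simp add: det_2 matrix_def inner_real2 axis_def algebra_simps)
    ultimately show "\<bar>det (matrix (frechet_derivative F (at z)))\<bar> = norm (v (\<Phi> (z $ 1) 0))"
      by (simp add: frechet_derivative_at[OF der, symmetric])
  qed
  have "inj_on F S"
  proof (rule inj_onI)
    have less: "\<psi> (\<Phi> s 0) < \<psi> (\<Phi> s' 0)" if "s < s'" "\<bar>s\<bar> < M" "\<bar>s'\<bar> < M" for s s'
    proof (rule DERIV_pos_imp_increasing[OF \<open>s < s'\<close>])
      fix u assume "s \<le> u" "u \<le> s'"
      then have "\<bar>u\<bar> < M" using that by auto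
      from psi_init[OF this] nz[OF init_ball[OF this]]
      show "\<exists>y. ((\<lambda>s. \<psi> (\<Phi> s 0)) has_real_derivative y) (at u) \<and> 0 < y"
        by (intro exI[of _ "norm (v (\<Phi> u 0))"]) (simp add: has_field_derivative_def mult_commute_abs)
    qed
    fix y z assume yz: "y \<in> S" "z \<in> S" "F y = F z"
    then have "\<psi> (\<Phi> (y $ 1) 0) = \<psi> (\<Phi> (z $ 1) 0)"
      using psi_flow unfolding F_def S by metis
    then have eq1: "y $ 1 = z $ 1"
      using less[of "y $ 1" "z $ 1"] less[of "z $ 1" "y $ 1"] yz S by fastforce
    \<comment> \<open>Points with equal \<open>s\<close> lie on the same flow line, where a
      coincidence at two times would close an orbit.\<close>
    have no_loop: False if ab: "a < b" "\<bar>a\<bar> < T" "\<bar>b\<bar> < T" "\<Phi> (z $ 1) a = \<Phi> (z $ 1) b" for a b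
    proof (rule no_closed_orbit[OF ab(1,4) _ _ contv[OF order_refl] nz psi])
      fix t assume "t \<in> {a..b}"
      then have t: "\<bar>t\<bar> < T" using ab by auto
      have z1: "\<bar>z $ 1\<bar> < M" using yz S by auto
      show "(\<Phi> (z $ 1) has_vector_derivative v (\<Phi> (z $ 1) t)) (at t)" by (rule solv[OF z1 t])
      show "\<Phi> (z $ 1) t \<in> ball 0 R" using stay[OF z1 t] sub by auto
    qed
    then have "y $ 2 = z $ 2"
      using no_loop[of "y $ 2" "z $ 2"] no_loop[of "z $ 2" "y $ 2"] yz eq1 S unfolding F_def
      by (metis linorder_neqE_linordered_idom)
    with eq1 show "y = z" by (simp add: vec_eq_iff forall_2)
  qed
  have Sleb: "S \<in> sets lebesgue" by (simp add: S_def)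
  have S_cbox: "integral S (\<lambda>_. c) = 4 * M * T * c" "(\<lambda>_. k) integrable_on S" for k :: real
  proof -
    have "measure lborel (cbox (vector [-M, -T]) (vector [M, T]) :: (real^2) set) = 4 * M * T"
      using pos by (subst content_cbox_cart) (auto simp: interval_ne_empty_cart forall_2 vector_2 UNIV_2)
    then show "integral S (\<lambda>_. c) = 4 * M * T * c"
      by (simp add: S_def integral_open_interval)
    show "(\<lambda>_. k) integrable_on S" unfolding S_def integrable_on_open_interval by (rule integrable_const)
  qed
  obtain B where B: "\<And>x. x \<in> ?C \<Longrightarrow> norm (v x) \<le> B"
    using compact_imp_bounded[OF compact_continuous_image[OF contv[OF sub] compact_cball]]
    unfolding bounded_iff ball_simps(9) by blast
  \<comment> \<open>Integrability of the Jacobian is obtained from this explicit expression, which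
    is bounded and continuous on \<open>S\<close>; continuity of the derivative of \<open>F\<close>
    is not at hand.\<close>
  have int: "(\<lambda>z. norm (v (\<Phi> (z $ 1) 0))) integrable_on S"
  proof (rule measurable_bounded_by_integrable_imp_integrable[OF _ S_cbox(2)[of B] _ Sleb])
    show "norm (norm (v (\<Phi> (z $ 1) 0))) \<le> B" if "z \<in> S" for z
      using B[OF stay[of "z $ 1" 0]] that pos by (simp add: S)
    have "continuous_on {s. \<bar>s\<bar> < M} (\<lambda>s. \<Phi> s 0)"
      using init by (intro continuous_at_imp_continuous_on) (blast intro: has_vector_derivative_continuous)
    then have "continuous_on S (\<lambda>z. \<Phi> (z $ 1) 0)"
      by (rule continuous_on_compose2[where f = "\<lambda>z. z $ 1"]) (auto simp: S intro: continuous_intros)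
    then have "continuous_on S (\<lambda>z. v (\<Phi> (z $ 1) 0))"
      by (rule continuous_on_compose2[OF contv[OF order_refl]]) (use init_ball S in blast)
    then have "continuous_on S (\<lambda>z. norm (v (\<Phi> (z $ 1) 0)))"
      by (rule continuous_on_norm)
    then show "(\<lambda>z. norm (v (\<Phi> (z $ 1) 0))) \<in> borel_measurable (lebesgue_on S)"
      by (rule continuous_imp_measurable_on_sets_lebesgue[OF _ Sleb])
  qed
  then have int': "(\<lambda>z. \<bar>det (matrix (frechet_derivative F (at z)))\<bar>) integrable_on S"
    by (rule integrable_eq) (simp add: det)
  have F'': "(F has_derivative frechet_derivative F (at z)) (at z within S)" if "z \<in> S" for z
    using F'[OF that] by (rule has_derivative_at_withinI)
  have "c * (4 * M * T) = integral S (\<lambda>_. c)" by (simp add: S_cbox)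
  also have "\<dots> \<le> integral S (\<lambda>z. \<bar>det (matrix (frechet_derivative F (at z)))\<bar>)"
    using det c init_ball S by (intro integral_le S_cbox int') auto
  also have "\<dots> = measure lebesgue (F ` S)"
    by (rule measure_differentiable_image_eq[OF Sleb F'' \<open>inj_on F S\<close> int', symmetric])
  also have "\<dots> \<le> measure lebesgue ?C"
  proof (rule measure_mono_fmeasurable)
    show "F ` S \<subseteq> ?C" using FC by blast
    show "F ` S \<in> sets lebesgue"
      using measurable_differentiable_image_eq[OF Sleb F'' \<open>inj_on F S\<close>] int' by (simp add: fmeasurableD)
  qed simp
  finally show ?thesis .
qed

text \<open>Instead of inverting the length function, its inverse \<open>\<sigma>\<close> is found
  as the solution of a differential equation. The lower bound on the speed makes the right-hand side
  bounded and globally Lipschitz, so \<open>\<sigma>\<close> exists on the whole line.\<close>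

lemma arclength_parameter:
  fixes \<gamma> :: "real \<Rightarrow> 'a::euclidean_space"
  assumes w: "K-lipschitz_on UNIV w" and c: "0 < c\<^sub>1" "\<And>x. c\<^sub>1 \<le> norm (w x)" "\<And>x. norm (w x) \<le> c\<^sub>2"
    and \<gamma>: "\<And>t. (\<gamma> has_vector_derivative w (\<gamma> t)) (at t)"
  obtains \<sigma> len :: "real \<Rightarrow> real"
  where "\<sigma> 0 = 0" "\<And>s. (\<sigma> has_real_derivative 1 / norm (w (\<gamma> (\<sigma> s)))) (at s)"
    "len 0 = 0" "\<And>t. (len has_real_derivative norm (w (\<gamma> t))) (at t)" "\<And>s. len (\<sigma> s) = s"
proof -
  have K: "0 \<le> K" by (rule lipschitz_on_nonneg[OF w])
  have c2: "0 < c\<^sub>2" using c less_le_trans order_trans by metis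
  have lip: "\<bar>norm (w (\<gamma> a)) - norm (w (\<gamma> b))\<bar> \<le> K * c\<^sub>2 * \<bar>a - b\<bar>" for a b
  proof -
    have "norm (\<gamma> a - \<gamma> b) \<le> c\<^sub>2 * norm (a - b)"
      using \<gamma> c(3) by (intro differentiable_bound[of UNIV _ "\<lambda>t h. h *\<^sub>R w (\<gamma> t)"])
        (auto simp: has_vector_derivative_def onorm_scaleR_left bounded_linear_ident onorm_id intro!: onorm_le mult_right_mono)
    then have "K * norm (\<gamma> a - \<gamma> b) \<le> K * (c\<^sub>2 * norm (a - b))" using K by (rule mult_left_mono)
    moreover have "\<bar>norm (w (\<gamma> a)) - norm (w (\<gamma> b))\<bar> \<le> K * norm (\<gamma> a - \<gamma> b)"
      using norm_triangle_ineq3 lipschitz_onD[OF w, of "\<gamma> a" "\<gamma> b"] unfolding dist_norm by (blast intro: order_trans)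
    ultimately show ?thesis by simp
  qed
  define g where "g t = 1 / norm (w (\<gamma> t))" for t
  have g_lip: "norm (g a - g b) \<le> K * c\<^sub>2 / c\<^sub>1\<^sup>2 * norm (a - b)" for a b
  proof -
    let ?p = "norm (w (\<gamma> a))" and ?q = "norm (w (\<gamma> b))"
    have p: "0 < ?p" "0 < ?q" "c\<^sub>1\<^sup>2 \<le> ?p * ?q"
      using c(1) c(2)[of "\<gamma> a"] c(2)[of "\<gamma> b"] by (auto simp: power2_eq_square intro: mult_mono less_le_trans)
    have "norm (g a - g b) = \<bar>?p - ?q\<bar> / (?p * ?q)"
      using p by (simp add: g_def diff_frac_eq abs_minus_commute)
    also have "\<dots> \<le> (K * c\<^sub>2 * \<bar>a - b\<bar>) / c\<^sub>1\<^sup>2"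
      using p c(1) lip[of a b] K c2 by (intro frac_le) auto
    finally show ?thesis by simp
  qed
  have contg: "continuous_on UNIV g"
    using g_lip K c2 by (intro lipschitz_on_continuous_on[of "K * c\<^sub>2 / c\<^sub>1\<^sup>2"] lipschitz_onI) (auto simp: dist_norm)
  obtain \<sigma> where \<sigma>: "\<sigma> 0 = 0" "\<And>s. (\<sigma> has_vector_derivative g (\<sigma> s)) (at s)"
  proof (rule Picard_Lindeloef_global[of "\<lambda>_. g" "K * c\<^sub>2 / c\<^sub>1\<^sup>2" 0 "g 0"])
    show "continuous_on UNIV (\<lambda>(t::real, x). g x)"
      using continuous_on_compose2[OF contg continuous_on_snd[OF continuous_on_id]] by (simp add: case_prod_beta)
  qed (use g_lip in \<open>auto simp: g_def intro: that\<close>)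
  have contwg: "continuous_on UNIV (\<lambda>t. norm (w (\<gamma> t)))"
    using lip K c2 by (intro lipschitz_on_continuous_on[of "K * c\<^sub>2"] lipschitz_onI) (auto simp: dist_norm)
  then obtain len where len: "len 0 = 0" "\<And>t. (len has_vector_derivative norm (w (\<gamma> t))) (at t)"
    using antiderivative_UNIV by metis
  \<comment> \<open>That \<open>\<sigma>\<close> is a right inverse of \<open>len\<close> follows
    because \<open>len (\<sigma> s) - s\<close> has derivative 0 and starts at 0.\<close>
  have "((\<lambda>s. len (\<sigma> s) - s) has_real_derivative 0) (at x)" for x
  proof -
    have "0 < norm (w (\<gamma> (\<sigma> x)))" using c by (metis less_le_trans)
    moreover have "((\<lambda>s. len (\<sigma> s) - s) has_real_derivative norm (w (\<gamma> (\<sigma> x))) * g (\<sigma> x) - 1) (at x)"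
      using len(2) \<sigma>(2) by (intro DERIV_diff DERIV_chain2[of len _ \<sigma>] DERIV_ident)
        (auto simp: has_real_derivative_iff_has_vector_derivative)
    ultimately show ?thesis by (simp add: g_def)
  qed
  then have "len (\<sigma> s) - s = len (\<sigma> 0) - 0" for s
    by (intro DERIV_isconst_all) blast
  then have "len (\<sigma> s) = s" for s using len(1) \<sigma>(1) by simp
  then show thesis
    using len \<sigma> by (intro that[of \<sigma> len]) (auto simp: has_real_derivative_iff_has_vector_derivative g_def)
qed

text \<open>\<open>len\<close> is signed arc length and monotone, so an exit at a time
  \<open>\<tau>\<close> between 0 and \<open>t\<close> would bound the escape length by
  \<open>\<bar>len \<tau>\<bar> \<le> \<bar>len t\<bar> \<le> M\<close>.\<close>

lemma stays_before_escape_length: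
  fixes \<gamma> :: "real \<Rightarrow> 'a::euclidean_space"
  assumes lip: "lipschitz_inside_ball w R"
    and \<gamma>: "\<And>t. (\<gamma> has_vector_derivative w' (\<gamma> t)) (at t)" "\<gamma> 0 = 0" and contw: "continuous_on UNIV w'"
    and agree: "\<And>x. x \<in> ball 0 r \<Longrightarrow> w' x = w x" and r: "1 < r" "r \<le> R"
    and len: "len 0 = 0" "\<And>t. (len has_real_derivative norm (w' (\<gamma> t))) (at t)"
    and M: "ereal M < unit_escape_length w (ball 0 R) 0" and t: "\<bar>len t\<bar> \<le> M"
  shows "norm (\<gamma> t) < 1"
proof (rule ccontr)
  assume exit: "\<not> ?thesis"
  have cont: "continuous_on UNIV \<gamma>"
    using \<gamma>(1) by (meson continuous_at_imp_continuous_on has_vector_derivative_continuous)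
  obtain \<tau> where \<tau>: "\<tau> \<in> closed_segment 0 t" "norm (\<gamma> \<tau>) = 1"
    and le: "\<And>u. u \<in> closed_segment 0 \<tau> \<Longrightarrow> norm (\<gamma> u) \<le> 1"
    using first_unit_exit[OF cont, of t] exit \<gamma>(2) by (auto simp: not_less)
  have stay: "\<gamma> u \<in> ball 0 r" if "u \<in> closed_segment 0 \<tau>" for u
    using le[OF that] r by auto
  obtain I where I: "integral_curve w (ball 0 R) (\<gamma> 0) I \<gamma>" "closed_segment 0 \<tau> \<subseteq> I"
    using integral_curve_of_global_solution[of \<gamma> w' r w R \<tau>, OF \<gamma>(1) agree r(2) stay] by blast
  have "continuous_on UNIV (\<lambda>u. norm (w' (\<gamma> u)))"
    using continuous_on_compose2[OF contw cont] by (auto intro: continuous_intros)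
  then have "(LBINT u=ereal 0..ereal \<tau>. norm (w' (\<gamma> u))) = len \<tau> - len 0"
    using len(2) by (intro interval_integral_FTC_finite)
      (auto intro: continuous_on_subset has_vector_derivative_at_within simp: has_real_derivative_iff_has_vector_derivative)
  moreover have "(LBINT u=ereal 0..ereal \<tau>. norm (w (\<gamma> u))) = (LBINT u=ereal 0..ereal \<tau>. norm (w' (\<gamma> u)))"
    using stay agree by (intro interval_integral_cong)
      (auto simp: closed_segment_eq_real_ivl einterval_def min_def max_def simp del: mem_ball split: if_splits)
  moreover have "\<tau> \<in> I" using I(2) by auto
  ultimately have "unit_escape_length w (ball 0 R) 0 \<le> ereal \<bar>len \<tau>\<bar>"
    using unit_escape_length_le[OF lip I(1)] \<tau>(2) \<gamma>(2) len(1) by force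
  moreover have "\<bar>len \<tau>\<bar> \<le> \<bar>len t\<bar>"
  proof -
    have mono: "len a \<le> len b" if "a \<le> b" for a b
      by (rule DERIV_nonneg_imp_nondecreasing[OF that]) (use len(2) norm_ge_zero in blast)
    show ?thesis
      using \<tau>(1) mono[of 0 \<tau>] mono[of \<tau> t] mono[of \<tau> 0] mono[of t \<tau>] len(1)
      by (auto simp: closed_segment_eq_real_ivl split: if_splits)
  qed
  ultimately have "unit_escape_length w (ball 0 R) 0 \<le> ereal M"
    using t by (metis ereal_less_eq(3) order_trans)
  with M show False by simp
qed

section \<open>Comparing the area swept out by the flow with the area of the disk of radius
  2\<close>

theorem theorem2:
  fixes v :: "real^2 \<Rightarrow> real^2" and c\<^sub>1 c\<^sub>2 L :: real
  assumes "0 < c\<^sub>1" and "c\<^sub>1 < c\<^sub>2" and "0 < L"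
    and "smooth_on v (ball 0 2)"
    and "incompressible_on v (ball 0 2)"
    and "\<And>p. p \<in> ball 0 2 \<Longrightarrow> c\<^sub>1 \<le> norm (v p) \<and> norm (v p) \<le> c\<^sub>2"
    and "\<And>p. p \<in> ball 0 1 \<Longrightarrow> ereal L \<le> unit_escape_length v (ball 0 2) p"
  shows "unit_escape_length (perp v) (ball 0 2) 0 \<le> ereal (pi * ((c\<^sub>2 / c\<^sub>1) / L))"
proof (rule ccontr)
  assume contra: "\<not> ?thesis"
  \<comment> \<open>\<open>M\<close> and \<open>T\<close> are balanced so that
    \<open>c\<^sub>1 * (4 * M * T)\<close> equals \<open>4 * pi\<close>, the area of the disk of
    radius 2.\<close>
  define M where "M = pi * ((c\<^sub>2 / c\<^sub>1) / L)"
  define T where "T = L / c\<^sub>2"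
  have MT: "0 < M" "0 < T" using assms(1-3) by (auto simp: M_def T_def)
  have v2: "Ck_on (Suc (Suc 0)) v (ball 0 2)" using assms(4) by (auto simp only: smooth_on_def)
  then have v1: "Ck_on (Suc 0) v (ball 0 2)" by (rule Ck_on_Suc_imp)
  have lipv: "\<exists>K. K-lipschitz_on (cball 0 r) v" if "r < 2" for r
  proof -
    have "cball (0::real^2) r \<subseteq> ball 0 2" using that by auto
    then obtain K where "0 \<le> K" "\<And>x y. x \<in> cball 0 r \<Longrightarrow> y \<in> cball 0 r \<Longrightarrow> norm (v x - v y) \<le> K * norm (x - y)"
      using C1_lipschitz[OF v1 compact_cball convex_cball] by metis
    then show ?thesis by (intro exI[of _ K] lipschitz_onI) (auto simp: dist_norm)
  qed
  have lipp: "\<exists>K. K-lipschitz_on (cball 0 r) (perp v)" if "r < 2" for r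
  proof -
    obtain K where K: "K-lipschitz_on (cball 0 r) v" using lipv[OF \<open>r < 2\<close>] by blast
    have "dist (perp v x) (perp v y) = dist (v x) (v y)" for x y
      by (simp add: perp_eq_rot90 dist_norm flip: linear_diff[OF linear_rot90])
    then show ?thesis using K by (auto simp: lipschitz_on_def)
  qed
  have lipv': "lipschitz_inside_ball v 2" and lipp': "lipschitz_inside_ball (perp v) 2"
    using lipv lipp by (auto simp: lipschitz_inside_ball_def)

  obtain K1 where K1: "K1-lipschitz_on (cball 0 (3/2)) (perp v)" using lipp[of "3/2"] by auto
  \<comment> \<open>The trajectory matters only up to its first exit from the unit disk, so the
    field may be altered outside the disk of radius 3/2.\<close>
  define w1 where "w1 x = perp v (closest_point (cball 0 (3/2)) x)" for x
  note w1 = lipschitz_cball_extension[OF _ K1, folded w1_def, simplified]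
  have w1_bound: "c\<^sub>1 \<le> norm (w1 x)" "norm (w1 x) \<le> c\<^sub>2" for x
  proof -
    obtain y where "y \<in> cball 0 (3/2)" "w1 x = perp v y" using w1(3)[of x] by auto
    then show "c\<^sub>1 \<le> norm (w1 x)" "norm (w1 x) \<le> c\<^sub>2" using assms(6)[of y] by (auto simp: perp_eq_rot90)
  qed
  have contw1: "continuous_on UNIV w1" by (rule lipschitz_on_continuous_on[OF w1(1)])
  obtain \<gamma> where \<gamma>: "\<gamma> 0 = 0" "\<And>t. (\<gamma> has_vector_derivative w1 (\<gamma> t)) (at t)"
  proof (rule Picard_Lindeloef_global[of "\<lambda>_. w1" K1 0 c\<^sub>2])
    show "continuous_on UNIV (\<lambda>(t::real, x). w1 x)"
      using continuous_on_compose2[OF contw1 continuous_on_snd[OF continuous_on_id]] by (simp add: case_prod_beta)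
    show "norm (w1 x - w1 y) \<le> K1 * norm (x - y)" for x y
      using lipschitz_onD[OF w1(1), of x y] by (simp add: dist_norm)
  qed (use w1_bound in \<open>auto intro: that\<close>)
  obtain \<sigma> len :: "real \<Rightarrow> real"
    where \<sigma>: "\<sigma> 0 = 0" "\<And>s. (\<sigma> has_real_derivative 1 / norm (w1 (\<gamma> (\<sigma> s)))) (at s)"
      and len: "len 0 = 0" "\<And>t. (len has_real_derivative norm (w1 (\<gamma> t))) (at t)" "\<And>s. len (\<sigma> s) = s"
    using arclength_parameter[OF w1(1) assms(1) w1_bound \<gamma>(2)] by metis
  define \<beta> where "\<beta> s = \<gamma> (\<sigma> s)" for s
  have \<beta>: "\<beta> 0 = 0" "(\<beta> has_vector_derivative w1 (\<beta> s) /\<^sub>R norm (w1 (\<beta> s))) (at s)" for s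
    using vector_diff_chain_at[OF \<sigma>(2)[unfolded has_real_derivative_iff_has_vector_derivative] \<gamma>(2)]
    by (auto simp: \<beta>_def[abs_def] o_def \<sigma>(1) \<gamma>(1) divide_inverse)
  \<comment> \<open>The bound holds for both signs of \<open>s\<close>, because the escape length
    takes the infimum over both directions of time.\<close>
  have \<beta>_less: "norm (\<beta> s) < 1" if "\<bar>s\<bar> \<le> M" for s
    unfolding \<beta>_def
    by (rule stays_before_escape_length[OF lipp' \<gamma>(2,1) contw1 _ _ _ len(1,2), of "3/2" M])
       (use contra that len(3) w1(2) in \<open>auto simp: M_def\<close>)
  have cont\<beta>: "continuous_on {-M..M} \<beta>"
    using \<beta>(2) by (intro continuous_at_imp_continuous_on) (blast intro: has_vector_derivative_continuous)
  \<comment> \<open>Compactness of the arc, endpoints included, improves the radius 1 to some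
    \<open>\<rho> < 1\<close>; the strict inequality at the end rests on this.\<close>
  obtain \<rho> where \<rho>: "\<rho> < 1" "\<beta> ` {-M..M} \<subseteq> cball 0 \<rho>"
    using compact_subset_ball_imp_cball[OF compact_continuous_image[OF cont\<beta> compact_Icc], of 1] \<beta>_less
    by (auto simp: image_subset_iff abs_le_iff)
  have \<beta>_le: "norm (\<beta> s) \<le> \<rho>" if "\<bar>s\<bar> \<le> M" for s
    using \<rho>(2) that by (auto simp: image_subset_iff abs_le_iff)
  have "0 \<le> \<rho>" using \<beta>_le[of 0] \<beta>(1) MT by simp

  \<comment> \<open>The midpoint of \<open>1 + \<rho>\<close> and 2: the closed unit disks around
    all \<open>\<beta> s\<close> with \<open>\<bar>s\<bar> \<le> M\<close> fit inside, and the field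
    is Lipschitz there.\<close>
  define r where "r = (3 + \<rho>) / 2"
  have r: "1 + \<rho> < r" "r < 2" "0 \<le> r" using \<rho>(1) \<open>0 \<le> \<rho>\<close> by (auto simp: r_def)
  obtain K2 where K2: "K2-lipschitz_on (cball 0 r) v" using lipv[OF r(2)] by blast
  define w2 where "w2 x = v (closest_point (cball 0 r) x)" for x
  note w2 = lipschitz_cball_extension[OF r(3) K2, folded w2_def]
  have w2_bound: "norm (w2 x) \<le> c\<^sub>2" for x
  proof -
    obtain y where "y \<in> cball 0 r" "w2 x = v y" using w2(3)[of x] by auto
    then show "norm (w2 x) \<le> c\<^sub>2" using assms(6)[of y] r(2) by auto
  qed
  have contw2: "continuous_on UNIV w2" by (rule lipschitz_on_continuous_on[OF w2(1)])
  have "\<exists>X. X 0 = x \<and> (\<forall>t. (X has_vector_derivative w2 (X t)) (at t))" for x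
  proof (rule Picard_Lindeloef_global[of "\<lambda>_. w2" K2 x c\<^sub>2])
    show "continuous_on UNIV (\<lambda>(t::real, x). w2 x)"
      using continuous_on_compose2[OF contw2 continuous_on_snd[OF continuous_on_id]] by (simp add: case_prod_beta)
    show "norm (w2 x - w2 y) \<le> K2 * norm (x - y)" for x y
      using lipschitz_onD[OF w2(1), of x y] by (simp add: dist_norm)
  qed (use w2_bound in auto)
  then have "\<exists>\<Phi>. \<forall>s. \<Phi> s 0 = \<beta> s \<and> (\<forall>t. (\<Phi> s has_vector_derivative w2 (\<Phi> s t)) (at t))"
    by (intro choice) blast
  then obtain \<Phi> where \<Phi>: "\<And>s. \<Phi> s 0 = \<beta> s" "\<And>s t. (\<Phi> s has_vector_derivative w2 (\<Phi> s t)) (at t)"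
    by blast
  have stay: "\<Phi> s t \<in> cball 0 (1 + \<rho>)" if s: "\<bar>s\<bar> < M" and t: "\<bar>t\<bar> < T" for s t
  proof -
    have "norm (\<Phi> s t - \<Phi> s 0) < 1"
    proof (rule stays_in_unit_ball[OF lipv' \<Phi>(2) contw2 _ _ _ w2_bound])
      show "w2 x = v x" if "x \<in> ball 0 r" for x using w2(2) that by simp
      show "norm (\<Phi> s 0) + 1 < r" using \<beta>_le[of s] s r(1) by (simp add: \<Phi>(1))
      show "ereal L \<le> unit_escape_length v (ball 0 2) (\<Phi> s 0)"
        using \<beta>_less[of s] s by (intro assms(7)) (simp add: \<Phi>(1))
      show "c\<^sub>2 * \<bar>t\<bar> < L" using t assms(1,2) by (simp add: T_def pos_less_divide_eq mult.commute)
    qed (use r in auto)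
    then show ?thesis
      using norm_triangle_ineq2[of "\<Phi> s t" "\<Phi> s 0"] \<beta>_le[of s] s by (simp add: \<Phi>(1))
  qed
  have "c\<^sub>1 * (4 * M * T) \<le> measure lebesgue (cball (0::real^2) (1 + \<rho>))"
  proof (rule area_swept_by_flow[OF v2 assms(5,1) _ _ w2(1) _ \<Phi>(2) _ stay MT])
    show "((\<lambda>s. \<Phi> s 0) has_vector_derivative rot90 (v (\<Phi> s 0)) /\<^sub>R norm (v (\<Phi> s 0))) (at s)" if "\<bar>s\<bar> < M" for s
      using \<beta>(2)[of s] \<beta>_less[of s] that w1(2)[of "\<beta> s"] by (simp add: \<Phi>(1) perp_eq_rot90)
    show "w2 x = v x" if "x \<in> cball 0 (1 + \<rho>)" for x using w2(2) that r by simp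
  qed (use assms(6) \<rho>(1) in auto)
  also have "\<dots> = (1 + \<rho>)\<^sup>2 * pi"
    using \<open>0 \<le> \<rho>\<close> by (simp add: content_cball unit_ball_vol_2)
  also have "\<dots> < 2\<^sup>2 * pi"
    using \<rho>(1) \<open>0 \<le> \<rho>\<close> by (intro mult_strict_right_mono power_strict_mono) auto
  \<comment> \<open>By the choice of \<open>M\<close> and \<open>T\<close> the left-hand side is
    exactly \<open>4 * pi\<close>, so the strict inequality is absurd.\<close>
  finally show False
    using assms(1-3) by (simp add: M_def T_def)
qed

end
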